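(* Let $w$ be a positive integer and $\phi=\frac{1+\sqrt5}{2}$. The value of the on-line chain partition game for up-growing semi-orders of width $w$ is $\lfloor \phi\cdot w\rfloor$. That is: (i) Algorithm has a strategy that, against every presentation by Spoiler of an up-growing semi-order of width at most $w$, uses at most $\lfloor \phi w\rfloor$ chains; and (ii) Spoiler has a strategy presenting an up-growing semi-order of width $w$ that forces every Algorithm to use at least $\lfloor \phi w\rfloor$ chains.
   Context: A semi-order is a partial order $P$ admitting a unit interval representation: a map $I$ from $P$ to closed real intervals of length $1$ such that $x<y$ in $P$ iff $I(x)$ lies entirely to the left of $I(y)$ (equivalently, $P$ contains neither two disjoint 2-element chains with no comparabilities between them, i.e. $\mathbf{2+2}$, nor a 3-element chain together with a point incomparable to all three, i.e. $\mathbf{3+1}$). The on-line chain partition game is played between Spoiler and Algorithm: Spoiler presents the points of a finite poset one at a time, revealing with each new point its comparabilities with all previously presented points; Algorithm immediately and irrevocably assigns each new point to a chain, so that at every moment the assignment is a partition of the points presented so far into chains. In the up-growing variant, each newly presented point must be a maximal element of the order presented so far. The value of the game for up-growing semi-orders of width $w$ is the least integer $n$ such that Algorithm has a strategy using at most $n$ chains whenever the presented order is an up-growing semi-order of width at most $w$ (equivalently, the largest $n$ such that Spoiler can force $n$ chains on such orders). *)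

theory Defs
  imports Complex_Main
begin

text \<open>A presentation of length n: the points are 0,1,...,n-1, presented in this order,
  and P x y means x < y in the presented poset (only x, y < n matter).\<close>

definition semiorder :: "nat \<Rightarrow> (nat \<Rightarrow> nat \<Rightarrow> bool) \<Rightarrow> bool" where
  "semiorder n P \<longleftrightarrow> (\<exists>f :: nat \<Rightarrow> real. \<forall>x<n. \<forall>y<n. P x y \<longleftrightarrow> f x + 1 < f y)"
  \<comment> \<open>unit interval representation: I(x) = [f x, f x + 1]\<close>

definition up_growing :: "nat \<Rightarrow> (nat \<Rightarrow> nat \<Rightarrow> bool) \<Rightarrow> bool" where
  "up_growing n P \<longleftrightarrow> (\<forall>k<n. \<forall>j<k. \<not> P k j)"

definition antichain :: "(nat \<Rightarrow> nat \<Rightarrow> bool) \<Rightarrow> nat set \<Rightarrow> bool" where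
  "antichain P S \<longleftrightarrow> (\<forall>x\<in>S. \<forall>y\<in>S. \<not> P x y)"

definition width :: "nat \<Rightarrow> (nat \<Rightarrow> nat \<Rightarrow> bool) \<Rightarrow> nat" where
  "width n P = Max {card S | S. S \<subseteq> {..<n} \<and> antichain P S}"

text \<open>An on-line algorithm maps a presented order and an index k to the chain (label) of
  point k; the choice may only depend on the order restricted to the points 0..k.\<close>

definition online :: "((nat \<Rightarrow> nat \<Rightarrow> bool) \<Rightarrow> nat \<Rightarrow> nat) \<Rightarrow> bool" where
  "online A \<longleftrightarrow> (\<forall>P Q k. (\<forall>x\<le>k. \<forall>y\<le>k. P x y = Q x y) \<longrightarrow> A P k = A Q k)"

definition chain_partition :: "nat \<Rightarrow> (nat \<Rightarrow> nat \<Rightarrow> bool) \<Rightarrow> (nat \<Rightarrow> nat) \<Rightarrow> bool" where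
  "chain_partition n P c \<longleftrightarrow>
     (\<forall>x<n. \<forall>y<n. x \<noteq> y \<and> c x = c y \<longrightarrow> P x y \<or> P y x)"

definition chains_used :: "nat \<Rightarrow> (nat \<Rightarrow> nat) \<Rightarrow> nat" where
  "chains_used n c = card (c ` {..<n})"

definition valid_input :: "nat \<Rightarrow> nat \<Rightarrow> (nat \<Rightarrow> nat \<Rightarrow> bool) \<Rightarrow> bool" where
  "valid_input w n P \<longleftrightarrow> semiorder n P \<and> up_growing n P \<and> width n P \<le> w"

end

theory Submission
  imports Defs
begin

text \<open>
  Upper bound: best fit, which puts a new point x on the chain whose top t < x has the largest
  down set. Call a point tight if everything below it has a chain successor and its own chain
  predecessor, if any, is not among the highest points below it; the last chain opener is tight.
  Take a tight x with the largest down set. Relative to x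
  the relevant part of the order has three layers: the rank class of the highest points of the down
  set of x, an antichain V around x, and an antichain B above x. Too many chains force many points
  of B to skip V. A point of B skips an upper part W of V only if everything of W below it is used,
  and since W together with the points of B not above it forms an antichain, many skips use up a lot
  of W; the points of B doing so in turn skip a higher part of V. The loss in each step
  is governed by the golden ratio, and an infinite descent results.

  Lower bound: Spoiler starts with an antichain of w points and presents a top layer one point at a time.
  Each top point marks the point below it on the same chain. If the marked point lies in block l of
  the middle layer, the next top point is placed above the lower blocks and, in block l, above the
  marked points only, so that
  Algorithm has to fall back to a lower block and finally to the bottom layer. After some such runs
  the bottom points marked so far receive a new block of the middle layer above them. All chain
  predecessors are marked and there are as many marks as top points, so the number of
  chains is at least w plus the size of the middle layer. With R runs to go and budget Q, the
  width stays at most w as long as R is at most the golden ratio times Q, and the pair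
  (R, Q) with R > Q passes to (R - Q, 2 Q - R), which preserves this.
\<close>

section \<open>Upper bound: best fit\<close>

definition gr :: real where "gr = (1 + sqrt 5) / 2"

lemma gr_sq: "gr * gr = gr + 1"
  unfolding gr_def by (simp add: field_simps)

lemma gr_bounds: "3 / 2 < gr" "gr < 2"
proof -
  have "sqrt 4 < sqrt 5" "sqrt 5 < sqrt 9" by (simp_all only: real_sqrt_less_iff)
  moreover have "sqrt 4 = (2::real)" "sqrt 9 = (3::real)"
    using real_sqrt_unique[of 2 4] real_sqrt_unique[of 3 9] by auto
  ultimately show "3 / 2 < gr" "gr < 2" unfolding gr_def by auto
qed

section \<open>Golden-ratio bound on skips in a two-layer order\<close>

text \<open>
  \<open>Y\<close> are the points of \<open>B\<close> that skip \<open>V\<close> altogether, \<open>V0\<close> the points of \<open>V\<close> that stay on a chain of the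
  rank class below; \<open>rk v\<close> counts the points of that class below \<open>v\<close>, and \<open>\<sigma>\<close> is \<open>w\<close> minus the
  size of that class. Points are numbered in order of presentation, so they also serve as times.
\<close>

locale two_layer =
  fixes P :: "nat \<Rightarrow> nat \<Rightarrow> bool" and V B Y V0 :: "nat set" and rk :: "nat \<Rightarrow> nat"
    and pr :: "nat \<Rightarrow> nat option" and w \<sigma> n :: nat
  assumes fin_V: "finite V" and fin_B: "finite B"
    and window: "\<And>X C. X \<subseteq> V \<Longrightarrow> C \<subseteq> B \<Longrightarrow> (\<forall>x\<in>X. \<forall>b\<in>C. \<not> P x b) \<Longrightarrow> card X + card C \<le> w"
    and nested: "\<And>b b'. b \<in> B \<Longrightarrow> b' \<in> B \<Longrightarrow>
        (\<forall>v\<in>V. P v b \<longrightarrow> P v b') \<or> (\<forall>v\<in>V. P v b' \<longrightarrow> P v b)"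
    and rank: "\<And>u v b. u \<in> V \<Longrightarrow> v \<in> V \<Longrightarrow> b \<in> B \<Longrightarrow> rk v < rk u \<Longrightarrow> P u b \<Longrightarrow> P v b"
    and earlier: "\<And>v b. v \<in> V \<Longrightarrow> b \<in> B \<Longrightarrow> P v b \<Longrightarrow> v < b"
    and bound_B: "\<And>b. b \<in> B \<Longrightarrow> b < n"
    and pr_below: "\<And>v b. v \<in> V \<Longrightarrow> b \<in> B \<Longrightarrow> pr b = Some v \<Longrightarrow> P v b"
    and pr_inj: "\<And>v b b'. b \<in> B \<Longrightarrow> b' \<in> B \<Longrightarrow> pr b = Some v \<Longrightarrow> pr b' = Some v \<Longrightarrow> b = b'"
    and best_fit: "\<And>v b. v \<in> V \<Longrightarrow> b \<in> B \<Longrightarrow> P v b \<Longrightarrow>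
        (\<And>u. u \<in> V \<Longrightarrow> pr b = Some u \<Longrightarrow> rk u < rk v) \<Longrightarrow> \<exists>b'\<in>B. b' < b \<and> pr b' = Some v"
    and Y_sub: "Y \<subseteq> B" and Y_pr: "\<And>b v. b \<in> Y \<Longrightarrow> pr b = Some v \<Longrightarrow> v \<notin> V"
    and V0_sub: "V0 \<subseteq> V"
    and rank_time: "\<And>v. v \<in> V - V0 \<Longrightarrow> rk v \<le> card {b\<in>Y. b < v} + card V0"
    and rank_count: "\<And>\<theta>. card {v\<in>V. rk v \<le> \<theta>} \<le> \<theta> + \<sigma>"
    and rank_top: "\<exists>x\<in>V - V0. \<forall>v\<in>V. rk v \<le> rk x"
    and V_le_n: "\<And>v. v \<in> V \<Longrightarrow> v < n"
begin

definition y :: "nat \<Rightarrow> nat" where "y t = card {b\<in>Y. b < t}"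
definition used :: "nat \<Rightarrow> nat set" where "used t = {v\<in>V. \<exists>b\<in>B. b < t \<and> pr b = Some v}"
definition free :: "nat set \<Rightarrow> nat set" where "free W = {b\<in>B. \<forall>v\<in>W. \<not> P v b}"
definition skip :: "nat set \<Rightarrow> nat \<Rightarrow> nat set" where
  "skip W t = {b\<in>B. b < t \<and> (\<exists>v\<in>W. P v b) \<and> (\<forall>v\<in>W. pr b \<noteq> Some v)}"
definition upper :: "nat set \<Rightarrow> bool" where
  "upper W \<longleftrightarrow> W \<subseteq> V \<and> (\<forall>u\<in>V - W. \<forall>v\<in>W. rk u < rk v)"

lemma fin_Y: "finite Y"
  using Y_sub fin_B finite_subset by blast

lemma y_mono: "s \<le> t \<Longrightarrow> y s \<le> y t"
  unfolding y_def by (rule card_mono) (use fin_Y in auto)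

lemma y_Suc: "y (Suc t) \<le> Suc (y t)"
proof -
  have "{b\<in>Y. b < Suc t} \<subseteq> insert t {b\<in>Y. b < t}" by auto
  then have "card {b\<in>Y. b < Suc t} \<le> card (insert t {b\<in>Y. b < t})"
    by (rule card_mono[rotated]) (use fin_Y in auto)
  also have "\<dots> \<le> Suc (card {b\<in>Y. b < t})" by (rule card_insert_le_m1) auto
  finally show ?thesis unfolding y_def .
qed

lemma used_mono: "s \<le> t \<Longrightarrow> used s \<subseteq> used t"
  unfolding used_def by (auto dest: less_le_trans)

lemma fin_free: "finite (free W)" and fin_skip: "finite (skip W t)"
  unfolding free_def skip_def using fin_B by auto

lemma free_skip_disj: "free W \<inter> skip W t = {}"
  unfolding free_def skip_def by auto

lemma upper_fin: "upper W \<Longrightarrow> finite W"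
  unfolding upper_def using fin_V finite_subset by blast

text \<open>The predecessor of \<open>b\<close> is outside \<open>W\<close>, so if it lies in
  \<open>V\<close> its rank is below that of \<open>v\<close>, because \<open>W\<close> is upper.
  Best fit would have preferred \<open>v\<close>; hence \<open>v\<close> already had a
  successor.\<close>

lemma skip_used:
  assumes "upper W" "b \<in> skip W t" "v \<in> W" "P v b"
  shows "v \<in> used t"
proof -
  have b: "b \<in> B" "b < t" "\<forall>v\<in>W. pr b \<noteq> Some v" using assms(2) unfolding skip_def by auto
  have v: "v \<in> V" using assms unfolding upper_def by auto
  have "\<exists>b'\<in>B. b' < b \<and> pr b' = Some v"
  proof (rule best_fit[OF v b(1) assms(4)])
    fix u assume "u \<in> V" "pr b = Some u"
    then show "rk u < rk v" using assms(1,3) b(3) unfolding upper_def by blast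
  qed
  then show ?thesis unfolding used_def using v b(2) less_trans by blast
qed

lemma window_le:
  assumes "upper W" shows "card W + card (free W) \<le> w"
  by (rule window) (use assms in \<open>auto simp: upper_def free_def\<close>)

text \<open>Choose \<open>b\<close> among the skipping points with the largest down set in
  \<open>V\<close>. By \<open>nested\<close>, the points of \<open>W\<close> not below
  \<open>b\<close> are below no point of \<open>skip W t\<close>, and by definition below no point
  of \<open>free W\<close>. So \<open>window\<close> applies to all of them, and many skips force
  many points of \<open>W\<close> below \<open>b\<close>.\<close>

lemma skip_window:
  assumes up: "upper W" and I: "L + y t + w \<le> card (free W) + card (skip W t) + y n + card W"
    and pos: "y n < L + y t"
  obtains b where "b \<in> skip W t" "L + y t \<le> card {v\<in>W. P v b} + y n"
proof -
  have "card (skip W t) > 0" using I pos window_le[OF up] by linarith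
  then have ne: "skip W t \<noteq> {}" by auto
  define k where "k b = card {v\<in>V. P v b}" for b
  obtain b where b: "b \<in> skip W t" and mx: "\<And>b'. b' \<in> skip W t \<Longrightarrow> k b' \<le> k b"
  proof -
    have "Max (k ` skip W t) \<in> k ` skip W t" using ne fin_skip by (intro Max_in) auto
    then obtain b where "b \<in> skip W t" "k b = Max (k ` skip W t)" by auto
    then show ?thesis using that fin_skip by (metis Max_ge finite_imageI imageI)
  qed
  have bB: "b \<in> B" using b unfolding skip_def by auto
  have sub: "P v b" if "b' \<in> skip W t" "v \<in> V" "P v b'" for b' v
  proof -
    have b'B: "b' \<in> B" using that unfolding skip_def by auto
    from nested[OF b'B bB] show ?thesis
    proof
      assume "\<forall>v\<in>V. P v b' \<longrightarrow> P v b" then show ?thesis using that by auto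
    next
      assume *: "\<forall>v\<in>V. P v b \<longrightarrow> P v b'"
      then have "{v\<in>V. P v b} \<subseteq> {v\<in>V. P v b'}" by auto
      moreover have "card {v\<in>V. P v b'} \<le> card {v\<in>V. P v b}" using mx[OF that(1)] unfolding k_def .
      ultimately have "{v\<in>V. P v b} = {v\<in>V. P v b'}"
        by (intro card_seteq) (use fin_V in auto)
      then show ?thesis using that by auto
    qed
  qed
  let ?K = "{v\<in>W. P v b}"
  have WV: "W \<subseteq> V" using up unfolding upper_def by auto
  have "card (W - ?K) + card (free W \<union> skip W t) \<le> w"
  proof (rule window)
    show "W - ?K \<subseteq> V" using WV by auto
    show "free W \<union> skip W t \<subseteq> B" unfolding free_def skip_def by auto
    show "\<forall>x\<in>W - ?K. \<forall>b\<in>free W \<union> skip W t. \<not> P x b"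
      using sub WV unfolding free_def by blast
  qed
  moreover have "card (free W \<union> skip W t) = card (free W) + card (skip W t)"
    by (rule card_Un_disjoint) (auto simp: fin_free fin_skip free_skip_disj)
  moreover have "card (W - ?K) = card W - card ?K"
    by (rule card_Diff_subset) (use upper_fin[OF up] in auto)
  moreover have "card ?K \<le> card W" by (rule card_mono) (use upper_fin[OF up] in auto)
  ultimately have "L + y t \<le> card ?K + y n" using I by linarith
  then show ?thesis using that b by blast
qed

text \<open>Shrinking \<open>W\<close> to \<open>W'\<close> keeps the old points of
  \<open>free\<close> and \<open>skip\<close> and gains the chain successors of points in
  \<open>W - W'\<close>. These are new, since each of them has its predecessor in \<open>W\<close>
  below it. \<open>T\<close> ensures that the skips counted at time \<open>s\<close> still count at
  time \<open>t\<close>.\<close>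

lemma skip_Un_used:
  assumes up: "upper W" and up': "upper W'" and sub: "W' \<subseteq> W"
    and T: "\<And>b. b \<in> skip W s \<Longrightarrow> b < t \<or> (\<forall>v\<in>W'. \<not> P v b)"
  shows "card (free W) + card (skip W s) + card ((W - W') \<inter> used t) \<le> card (free W') + card (skip W' t)"
proof -
  define U where "U = {b\<in>B. b < t \<and> (\<exists>v\<in>W - W'. pr b = Some v)}"
  have WV: "W \<subseteq> V" using up unfolding upper_def by auto
  have finU: "finite U" unfolding U_def using fin_B by auto
  have "(W - W') \<inter> used t \<subseteq> (\<lambda>b. the (pr b)) ` U"
    unfolding U_def used_def by force
  then have c1: "card ((W - W') \<inter> used t) \<le> card U"
    using finU by (meson card_image_le card_mono finite_imageI le_trans)
  have over: "\<exists>v\<in>W. P v b" if "b \<in> U" for b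
    using that WV pr_below unfolding U_def by blast
  have d1: "free W \<inter> skip W s = {}" by (rule free_skip_disj)
  have d2: "(free W \<union> skip W s) \<inter> U = {}"
    using over unfolding free_def skip_def U_def by blast
  have "card (free W) + card (skip W s) + card U = card (free W \<union> skip W s \<union> U)"
    using d1 d2 by (simp add: card_Un_disjoint fin_free fin_skip finU)
  also have "\<dots> \<le> card (free W' \<union> skip W' t)"
  proof (rule card_mono)
    show "finite (free W' \<union> skip W' t)" by (simp add: fin_free fin_skip)
    have a: "free W \<subseteq> free W'" using sub unfolding free_def by auto
    have b: "skip W s \<subseteq> free W' \<union> skip W' t"
      using T sub unfolding free_def skip_def by blast
    have c: "U \<subseteq> free W' \<union> skip W' t"
      unfolding U_def free_def skip_def by auto
    show "free W \<union> skip W s \<union> U \<subseteq> free W' \<union> skip W' t" using a b c by auto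
  qed
  also have "\<dots> \<le> card (free W') + card (skip W' t)" by (rule card_Un_le)
  finally show ?thesis using c1 by linarith
qed


text \<open>
  Invariant of the descent: from time \<open>t0\<close> on, at least \<open>L - (y n - y t)\<close> points skip \<open>W\<close>. The next upper part
  \<open>W'\<close> consists of points presented late enough that this number is positive when \<open>W'\<close> begins.
  If \<open>W - W'\<close> is never used up, the skips of \<open>W\<close> remain outside the range of \<open>W'\<close>, and \<open>L\<close> drops to
  \<open>2 * L - card (W - W')\<close>; if it is used up at some time \<open>tf\<close>, then \<open>L\<close> stays and \<open>t0\<close> becomes \<open>tf\<close>.
\<close>

lemma no_descent:
  assumes "upper W" and "t0 \<le> n" and "0 < L"
    and "\<And>t. t0 \<le> t \<Longrightarrow> t \<le> n \<Longrightarrow>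
        L + y t + w \<le> card (free W) + card (skip W t) + y n + card W"
    and "real (max (y n - L) (y t0)) + (2 * card V0 + \<sigma>) + card W - card V < gr * L"
  shows False
  using assms
proof (induction "card W" arbitrary: W L t0 rule: less_induct)
  case less
  note up = less.prems(1) and t0 = less.prems(2) and L = less.prems(3)
    and I = less.prems(4) and J = less.prems(5)
  define \<theta> where "\<theta> = max (y n - L) (y t0)"
  \<comment> \<open>One \<open>card V0\<close> is lost in \<open>rank_time\<close>: points of
    \<open>W' - V0\<close> are then presented when \<open>y\<close> exceeds
    \<open>\<theta> + card V0\<close>. The other one covers the points of \<open>V0\<close>, which
    may be presented earlier.\<close>
  define W' where "W' = {u\<in>W. \<theta> + 2 * card V0 < rk u}"
  define full where "full t \<longleftrightarrow> W - W' \<subseteq> used t" for t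
  have WV: "W \<subseteq> V" and finW: "finite W" using up upper_fin unfolding upper_def by auto
  have sub: "W' \<subseteq> W" and finW': "finite W'" unfolding W'_def using finW by auto
  have up': "upper W'" using up unfolding upper_def W'_def by fastforce
  have card_W: "card W = card W' + card (W - W')"
    using card_Diff_subset[OF finW' sub] card_mono[OF finW sub] by simp
  have rank_W': "rk c < rk u" if "c \<in> W - W'" "u \<in> W'" for c u
    using that unfolding W'_def by auto
  \<comment> \<open>A skip of \<open>W\<close> that lies above a point of \<open>W'\<close> lies
    above everything of lower rank, so by best fit all of \<open>W - W'\<close> has a successor
    already.\<close>
  have over: "W - W' \<subseteq> used t" if "b \<in> skip W t" "u \<in> W'" "P u b" for b u t
  proof
    fix c assume c: "c \<in> W - W'"
    have "P c b"
      by (rule rank[of u c b]) (use that c WV sub rank_W'[OF c] in \<open>auto simp: skip_def\<close>)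
    then show "c \<in> used t" using skip_used[OF up that(1)] c by auto
  qed
  have full_mono: "full s \<Longrightarrow> s \<le> t \<Longrightarrow> full t" for s t
    unfolding full_def using used_mono by blast
  \<comment> \<open>While \<open>full\<close> fails, \<open>over\<close> keeps the down set of a
    skip within \<open>W - W'\<close>, and by \<open>skip_used\<close> this down set has been used;
    \<open>skip_window\<close> gives its size.\<close>
  have seg: "L + y t \<le> card ((W - W') \<inter> used t) + y n"
    if t: "t0 \<le> t" "t \<le> n" "\<not> full t" for t
  proof (cases "y n < L + y t")
    case True
    obtain b where b: "b \<in> skip W t" "L + y t \<le> card {v\<in>W. P v b} + y n"
      using skip_window[OF up I[OF t(1,2)] True] by blast
    have "{v\<in>W. P v b} \<subseteq> (W - W') \<inter> used t"
      using over[OF b(1)] skip_used[OF up b(1)] t(3) unfolding full_def by blast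
    then have "card {v\<in>W. P v b} \<le> card ((W - W') \<inter> used t)"
      by (rule card_mono[rotated]) (use finW in auto)
    then show ?thesis using b(2) by linarith
  qed simp
  have I_full: "L + y t + w \<le> card (free W') + card (skip W' t) + y n + card W'"
    if t: "t0 \<le> t" "t \<le> n" "full t" for t
  proof -
    have "(W - W') \<inter> used t = W - W'" using t(3) unfolding full_def by auto
    then have "card (free W) + card (skip W t) + card (W - W') \<le> card (free W') + card (skip W' t)"
      using skip_Un_used[OF up up' sub, of t t] unfolding skip_def by auto
    then show ?thesis using I[OF t(1,2)] card_W by linarith
  qed
  \<comment> \<open>The witness is the first point of \<open>W' - V0\<close>. Points of
    \<open>B\<close> presented before it have only points of \<open>V0\<close> below them within
    \<open>W'\<close>, which is too few for \<open>skip_window\<close> applied to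
    \<open>W'\<close>.\<close>
  have early: "\<exists>t'. t0 \<le> t' \<and> t' \<le> n \<and> \<not> full t'" if ne: "W' \<noteq> {}"
  proof -
    obtain u where u: "u \<in> W'" using ne by auto
    obtain x where x: "x \<in> V - V0" "\<forall>v\<in>V. rk v \<le> rk x" using rank_top by auto
    have ux: "rk u \<le> rk x" using x u sub WV by auto
    have "x \<in> W"
    proof (rule ccontr)
      assume "x \<notin> W"
      then have "rk x < rk u" using up u x(1) sub unfolding upper_def by blast
      then show False using ux by simp
    qed
    then have "x \<in> W'" using ux u unfolding W'_def by simp
    then have xW: "x \<in> W' - V0" using x by auto
    define t' where "t' = (LEAST v. v \<in> W' - V0)"
    have t': "t' \<in> W' - V0" unfolding t'_def using xW by (rule LeastI)
    have least: "t' \<le> v" if "v \<in> W' - V0" for v unfolding t'_def using that by (rule Least_le)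
    have t'V: "t' \<in> V - V0" using t' sub WV by auto
    have yt: "\<theta> + card V0 < y t'"
      using rank_time[OF t'V] t' unfolding W'_def y_def by auto
    have tn: "t' \<le> n" using V_le_n t'V by force
    have tt: "t0 \<le> t'"
    proof (rule ccontr)
      assume "\<not> t0 \<le> t'"
      then have "y t' \<le> y t0" by (intro y_mono) simp
      then show False using yt unfolding \<theta>_def by simp
    qed
    have "\<not> full t'"
    proof
      assume full: "full t'"
      have pos: "y n < L + y t'" using yt unfolding \<theta>_def by linarith
      obtain b where b: "b \<in> skip W' t'" "L + y t' \<le> card {v\<in>W'. P v b} + y n"
        using skip_window[OF up' I_full[OF tt tn full] pos] by blast
      have "{v\<in>W'. P v b} \<subseteq> V0"
      proof
        fix v assume v: "v \<in> {v\<in>W'. P v b}"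
        then have "v < b" using earlier b(1) sub WV unfolding skip_def by blast
        then have "v < t'" using b(1) unfolding skip_def by auto
        then show "v \<in> V0" using least[of v] v by force
      qed
      then have "card {v\<in>W'. P v b} \<le> card V0"
        by (rule card_mono[rotated]) (use V0_sub fin_V finite_subset in auto)
      then show False using b(2) yt unfolding \<theta>_def by linarith
    qed
    then show ?thesis using tn tt by blast
  qed
  show False
  proof (cases "full n")
    case False
    have size: "L < card (W - W')"
    proof -
      have "(W - W') \<inter> used n \<subset> W - W'" using False unfolding full_def by auto
      then have "card ((W - W') \<inter> used n) < card (W - W')"
        by (rule psubset_card_mono[rotated]) (use finW in auto)
      then show ?thesis using seg[OF t0 order_refl False] by linarith
    qed
    then obtain c where c: "c \<in> W - W'" by (metis all_not_in_conv card.empty not_less0)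
    have "V - W' \<subseteq> {v\<in>V. rk v \<le> \<theta> + 2 * card V0}"
    proof
      fix v assume v: "v \<in> V - W'"
      have "rk c \<le> \<theta> + 2 * card V0" using c unfolding W'_def by auto
      moreover have "rk v < rk c" if "v \<notin> W" using up that c v unfolding upper_def by auto
      ultimately show "v \<in> {v\<in>V. rk v \<le> \<theta> + 2 * card V0}"
        using v unfolding W'_def by (cases "v \<in> W") auto
    qed
    then have "card (V - W') \<le> card {v\<in>V. rk v \<le> \<theta> + 2 * card V0}"
      by (rule card_mono[rotated]) (use fin_V in auto)
    also have "\<dots> \<le> \<theta> + 2 * card V0 + \<sigma>" by (rule rank_count)
    finally have p': "card (V - W') \<le> \<theta> + 2 * card V0 + \<sigma>" .
    have "card V = card W' + card (V - W')"
      using card_Diff_subset[OF finW', of V] card_mono[OF fin_V, of W'] sub WV by auto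
    then have R: "real (card (W - W')) \<le> real \<theta> + real (2 * card V0 + \<sigma>) + card W - card V"
      using p' card_W by simp
    have J': "real \<theta> + real (2 * card V0 + \<sigma>) + card W - card V < gr * L"
      using J unfolding \<theta>_def by simp
    have "gr * L < 2 * L" using gr_bounds L by simp
    then have le: "card (W - W') < 2 * L" using R J' by linarith
    define L' where "L' = 2 * L - card (W - W')"
    have L': "0 < L'" "real L' = 2 * real L - card (W - W')" using le unfolding L'_def by auto
    have I': "L' + y t + w \<le> card (free W') + card (skip W' t) + y n + card W'"
      if t: "t0 \<le> t" "t \<le> n" for t
    proof -
      have nf: "\<not> full t" using False full_mono t by blast
      \<comment> \<open>All skips up to time \<open>n\<close> may be counted at every
        \<open>t\<close>: since \<open>full n\<close> fails, \<open>over\<close> shows that none of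
        them lies above a point of \<open>W'\<close>, so they belong to
        \<open>free W'\<close>.\<close>
      have "card (free W) + card (skip W n) + card ((W - W') \<inter> used t)
          \<le> card (free W') + card (skip W' t)"
        by (rule skip_Un_used[OF up up' sub]) (use over False in \<open>auto simp: full_def\<close>)
      then show ?thesis
        using I[OF t0 order_refl] seg[OF t nf] card_W le unfolding L'_def by linarith
    qed
    have J'': "real (max (y n - L') (y t0)) + (2 * card V0 + \<sigma>) + card W' - card V < gr * L'"
    proof -
      let ?s = "real (card (W - W'))" and ?R = "real \<theta> + real (2 * card V0 + \<sigma>) + card W - card V"
      have "real (max (y n - L') (y t0)) \<le> real \<theta> + ?s - L"
        using size unfolding \<theta>_def L'_def by linarith
      then have 1: "real (max (y n - L') (y t0)) + (2 * card V0 + \<sigma>) + card W' - card V \<le> ?R - L"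
        using card_W by simp
      \<comment> \<open>Since gr + 1 is the square of gr, multiplying R < gr L by gr + 1 gives R - L
        < gr (2 L - R). Thus the passage from (R, L) to (R - L, 2 L - R) keeps the bound, and gr is
        the ratio it fixes.\<close>
      have "(gr + 1) * ?R < (gr + 1) * (gr * L)" using J' gr_bounds by simp
      also have "\<dots> = (gr * gr + gr) * L" by (simp add: algebra_simps)
      finally have "?R - L < gr * (2 * real L - ?R)" by (simp add: gr_sq algebra_simps)
      also have "\<dots> \<le> gr * L'" unfolding L'(2) using R gr_bounds by (intro mult_left_mono) auto
      finally show ?thesis using 1 by linarith
    qed
    show False
      by (rule less.hyps[OF _ up' t0 L'(1) I' J'']) (use size card_W in auto)
  next
    case True
    show False
    proof (cases "W' = {}")
      case emp: True
      have "L + w \<le> card (free W')"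
        using I_full[OF t0 order_refl True] emp by (simp add: skip_def)
      then show False using window_le[OF up'] L by linarith
    next
      case ne: False
      obtain t' where t': "t0 \<le> t'" "t' \<le> n" "\<not> full t'" using early[OF ne] by blast
      define tf where "tf = (LEAST t. full t)"
      have tf: "full tf" unfolding tf_def using True by (rule LeastI)
      have tf_n: "tf \<le> n" unfolding tf_def using True by (rule Least_le)
      have t'f: "t' < tf" using full_mono[OF tf] t'(3) by (meson not_le)
      then obtain s where s: "tf = Suc s" "t' \<le> s" by (cases tf) auto
      \<comment> \<open>At \<open>s\<close>, one step before \<open>tf\<close>, the segment is not
        yet full, so the bound of \<open>seg\<close> is strict there. This makes up for the at most
        one unit by which \<open>y\<close> grows from \<open>s\<close> to \<open>tf\<close>.\<close>
      have nf: "\<not> full s" using not_less_Least[of s full] s unfolding tf_def by auto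
      have "(W - W') \<inter> used s \<subset> W - W'" using nf unfolding full_def by auto
      then have "card ((W - W') \<inter> used s) < card (W - W')"
        by (rule psubset_card_mono[rotated]) (use finW in auto)
      moreover have "L + y s \<le> card ((W - W') \<inter> used s) + y n"
        by (rule seg) (use nf s t' tf_n in auto)
      ultimately have size: "L + y tf \<le> card (W - W') + y n" using y_Suc[of s] unfolding s(1) by linarith
      have "W - W' \<noteq> {}" using t'(3) unfolding full_def by auto
      then have "0 < card (W - W')" using finW by (simp add: card_gt_0_iff)
      then have less: "card W' < card W" using card_W by simp
      have J4: "real (max (y n - L) (y tf)) + (2 * card V0 + \<sigma>) + card W' - card V < gr * L"
      proof -
        have "real (max (y n - L) (y tf)) \<le> real (max (y n - L) (y t0)) + card (W - W')"
          using size by linarith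
        then show ?thesis using J card_W by simp
      qed
      have I4: "L + y t + w \<le> card (free W') + card (skip W' t) + y n + card W'"
        if "tf \<le> t" "t \<le> n" for t
        using I_full[of t] full_mono[OF tf] t'(1) t'f that by simp
      show False by (rule less.hyps[OF less up' tf_n L I4 J4])
    qed
  qed
qed

text \<open>The descent starts with \<open>W = V\<close>, time 0 and \<open>L\<close> the excess of
  \<open>card Y\<close> over \<open>w - card V\<close>. All points of \<open>Y\<close> lie in
  \<open>free V\<close> or skip \<open>V\<close>, which gives the initial invariant.\<close>

lemma golden_bound:
  "gr * (real (card Y) - (real w - card V)) \<le> real w - card V + 2 * card V0 + \<sigma>"
proof (rule ccontr)
  assume "\<not> ?thesis"
  then have *: "real w - card V + 2 * card V0 + \<sigma> < gr * (real (card Y) - (real w - card V))" by simp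
  have Vw: "card V \<le> w" using window[of V "{}"] by simp
  have "real (card V) \<le> real w" using Vw by simp
  then have "0 < gr * (real (card Y) - (real w - card V))" using * by linarith
  then have pos: "0 < real (card Y) - (real w - card V)" using gr_bounds by (simp add: zero_less_mult_iff)
  define L where "L = card Y - (w - card V)"
  have L: "real L = real (card Y) - (real w - card V)" "0 < L" "L + w = card Y + card V"
    unfolding L_def using pos Vw by (auto simp: of_nat_diff)
  have yn: "y n = card Y"
    unfolding y_def using bound_B Y_sub by (intro arg_cong[where f = card]) auto
  have y0: "y 0 = 0" unfolding y_def by simp
  show False
  proof (rule no_descent[of V 0 L])
    show "upper V" unfolding upper_def by auto
    fix t
    have "{b\<in>Y. b < t} \<subseteq> free V \<union> skip V t"
      unfolding free_def skip_def using Y_sub Y_pr by auto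
    then have "y t \<le> card (free V \<union> skip V t)"
      unfolding y_def by (rule card_mono[rotated]) (simp add: fin_free fin_skip)
    then have "y t \<le> card (free V) + card (skip V t)" using card_Un_le le_trans by blast
    then show "L + y t + w \<le> card (free V) + card (skip V t) + y n + card V"
      using yn L(3) by linarith
  next
    have "real (max (y n - L) (y 0)) = real w - card V"
      using L(3) yn y0 Vw by (simp add: of_nat_diff L_def)
    then show "real (max (y n - L) (y 0)) + real (2 * card V0 + \<sigma>) + card V - card V < gr * L"
      using * L(1) by simp
  qed (use L in auto)
qed

end


section \<open>Reduction of a best-fit run to the two-layer situation\<close>

locale best_fit_run =
  fixes n :: nat and P :: "nat \<Rightarrow> nat \<Rightarrow> bool" and f :: "nat \<Rightarrow> real"
    and pr :: "nat \<Rightarrow> nat option" and w :: nat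
  assumes rep: "\<And>x y. x < n \<Longrightarrow> y < n \<Longrightarrow> P x y \<longleftrightarrow> f x + 1 < f y"
    and up: "\<And>x y. x < n \<Longrightarrow> y < n \<Longrightarrow> P x y \<Longrightarrow> x < y"
    and width: "\<And>S. S \<subseteq> {..<n} \<Longrightarrow> antichain P S \<Longrightarrow> card S \<le> w"
    and pr_below: "\<And>b j. b < n \<Longrightarrow> pr b = Some j \<Longrightarrow> j < n \<and> P j b"
    and pr_inj: "\<And>b b' j. b < n \<Longrightarrow> b' < n \<Longrightarrow> pr b = Some j \<Longrightarrow> pr b' = Some j \<Longrightarrow> b = b'"
    and pr_best: "\<And>b j i. b < n \<Longrightarrow> i < n \<Longrightarrow> pr b = Some j \<Longrightarrow> P i b \<Longrightarrow>
        card {q. q < n \<and> P q j} < card {q. q < n \<and> P q i} \<Longrightarrow> \<exists>b'<b. pr b' = Some i"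
    and pr_None: "\<And>b i. b < n \<Longrightarrow> i < n \<Longrightarrow> pr b = None \<Longrightarrow> P i b \<Longrightarrow> \<exists>b'<b. pr b' = Some i"
begin

definition D :: "nat \<Rightarrow> nat set" where "D p = {q. q < n \<and> P q p}"
text \<open>Down sets in a semi-order are nested, so their sizes determine their inclusions and
  replace the left endpoints.\<close>

definition r :: "nat \<Rightarrow> nat" where "r p = card (D p)"

lemma fin_D: "finite (D p)" unfolding D_def by auto

lemma D_lt: "q \<in> D p \<Longrightarrow> q < n" unfolding D_def by auto

lemma D_mono: "x < n \<Longrightarrow> y < n \<Longrightarrow> f x \<le> f y \<Longrightarrow> D x \<subseteq> D y"
  unfolding D_def using rep by fastforce

lemma D_nested: "x < n \<Longrightarrow> y < n \<Longrightarrow> D x \<subseteq> D y \<or> D y \<subseteq> D x"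
  using D_mono by (meson linear)

lemma r_le: "x < n \<Longrightarrow> y < n \<Longrightarrow> r x \<le> r y \<Longrightarrow> D x \<subseteq> D y"
  unfolding r_def using D_nested[of x y] card_seteq[OF fin_D, of "D y" x] by auto

lemma r_mono: "D x \<subseteq> D y \<Longrightarrow> r x \<le> r y"
  unfolding r_def by (rule card_mono[OF fin_D])

lemma r_less_iff: "x < n \<Longrightarrow> y < n \<Longrightarrow> r x < r y \<longleftrightarrow> \<not> D y \<subseteq> D x"
  using r_le r_mono by (meson leD linorder_le_less_linear)

lemma r_less_f: "x < n \<Longrightarrow> y < n \<Longrightarrow> r x < r y \<Longrightarrow> f x < f y"
  using D_mono[of y x] r_mono by (meson leD linorder_le_less_linear)

lemma below: "c < n \<Longrightarrow> u < n \<Longrightarrow> b < n \<Longrightarrow> r c < r u \<Longrightarrow> P u b \<Longrightarrow> P c b"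
  using r_less_f rep by fastforce

lemma irrefl: "x < n \<Longrightarrow> \<not> P x x"
  using rep by auto

lemma P_trans: "x < n \<Longrightarrow> y < n \<Longrightarrow> z < n \<Longrightarrow> P x y \<Longrightarrow> P y z \<Longrightarrow> P x z"
  using rep by fastforce

lemma P_r: assumes "x < n" "y < n" "P x y" shows "r x < r y"
proof -
  have "x \<in> D y" "x \<notin> D x" using assms irrefl unfolding D_def by auto
  then show ?thesis using assms r_less_iff by blast
qed

lemma card_same_rank: "card {a. a < n \<and> r a = d} \<le> w"
  by (rule width) (auto simp: antichain_def dest: P_r)

definition used :: "nat \<Rightarrow> bool" where "used i \<longleftrightarrow> (\<exists>b<n. pr b = Some i)"

text \<open>Chains are counted by their tops; \<open>Q\<close> contains all tops, so it suffices to count chain entries into \<open>Q\<close>.\<close>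

lemma openers_le:
  assumes "\<And>i. i < n \<Longrightarrow> \<not> used i \<Longrightarrow> i \<in> Q" and "Q \<subseteq> {..<n}"
    and "\<And>b j. b < n \<Longrightarrow> pr b = Some j \<Longrightarrow> j \<in> Q \<Longrightarrow> b \<in> Q"
  shows "card {k. k < n \<and> pr k = None} \<le> card {k\<in>Q. \<forall>j\<in>Q. pr k \<noteq> Some j}"
proof -
  have finQ: "finite Q" using assms(2) finite_subset by blast
  define In where "In X = {b. b < n \<and> (\<exists>j\<in>X. pr b = Some j)}" for X
  have In: "card (In X) = card {j\<in>X. used j}" if "X \<subseteq> {..<n}" for X
  proof -
    have "inj_on (\<lambda>b. the (pr b)) (In X)"
      unfolding In_def by (rule inj_onI) (auto intro: pr_inj)
    moreover have "(\<lambda>b. the (pr b)) ` In X = {j\<in>X. used j}"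
      unfolding In_def used_def by force
    ultimately show ?thesis by (metis card_image)
  qed
  have "{k. k < n \<and> pr k = None} = {..<n} - In {..<n}"
  proof (rule set_eqI)
    fix k show "k \<in> {k. k < n \<and> pr k = None} \<longleftrightarrow> k \<in> {..<n} - In {..<n}"
      using pr_below[of k] unfolding In_def by (cases "pr k") auto
  qed
  moreover have "In X \<subseteq> {..<n}" for X unfolding In_def by auto
  ultimately have "card {k. k < n \<and> pr k = None} = n - card {j\<in>{..<n}. used j}"
    using In[of "{..<n}"] by (metis card_Diff_subset card_lessThan finite_lessThan finite_subset order_refl)
  also have "\<dots> = card ({..<n} - {j\<in>{..<n}. used j})"
    by (subst card_Diff_subset) auto
  also have "{..<n} - {j\<in>{..<n}. used j} = Q - {j\<in>Q. used j}"
    using assms(1,2) by auto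
  also have "card \<dots> = card Q - card {j\<in>Q. used j}"
    by (rule card_Diff_subset) (use finQ in auto)
  also have "\<dots> = card Q - card (In Q)" using In[OF assms(2)] by simp
  also have "\<dots> = card (Q - In Q)"
    by (rule card_Diff_subset[symmetric]) (use finQ assms(3) in \<open>auto simp: In_def\<close>)
  also have "Q - In Q = {k\<in>Q. \<forall>j\<in>Q. pr k \<noteq> Some j}"
    unfolding In_def using assms(2) by auto
  finally show ?thesis by simp
qed

text \<open>The run is cut right after its last opener \<open>x0\<close>. Being presented last,
  \<open>x0\<close> is maximal, and therefore so is every point of rank above
  \<open>r x0\<close>.\<close>

theorem openers_bound:
  assumes n: "n = Suc x0" and opener: "pr x0 = None"
  shows "real (card {k. k < n \<and> pr k = None}) \<le> gr * w"
proof -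
  have x0: "x0 < n" using n by simp
  have x0_max: "\<not> P x0 q" if "q < n" for q
    using up[OF x0 that] that n by auto
  \<comment> \<open>The last conjunct makes every point of rank above \<open>r x\<close> maximal, so
    that the layer \<open>B\<close> chosen below has nothing above it.\<close>
  define tight where "tight x \<longleftrightarrow> x < n \<and> D x \<noteq> {} \<and> (\<forall>d\<in>D x. used d) \<and>
      (\<forall>j. pr x = Some j \<longrightarrow> (\<exists>s\<in>D x. r j < r s)) \<and> r x0 \<le> r x" for x
  have opener_used: "used d" if "k < n" "pr k = None" "d \<in> D k" for k d
    using pr_None[of k d] that unfolding D_def used_def by (metis less_trans mem_Collect_eq)
  show ?thesis
  proof (cases "\<exists>x. tight x")
    case False
    \<comment> \<open>Best fit opens a chain only if everything below the new point has a successor.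
      So an opener of rank at least \<open>r x0\<close> with nonempty down set would be tight.
      Applied to \<open>x0\<close> first, this forces all openers to have rank 0, and they form an
      antichain.\<close>
    have "D x0 = {}" using False x0 opener opener_used unfolding tight_def by auto
    then have r0: "r x0 = 0" unfolding r_def by simp
    have "r k = 0" if "k < n" "pr k = None" for k
    proof -
      have "D k = {}" using False that r0 opener_used unfolding tight_def by auto
      then show ?thesis unfolding r_def by simp
    qed
    then have "{k. k < n \<and> pr k = None} \<subseteq> {a. a < n \<and> r a = 0}" by auto
    then have "card {k. k < n \<and> pr k = None} \<le> card {a. a < n \<and> r a = 0}"
      by (intro card_mono) auto
    then have "card {k. k < n \<and> pr k = None} \<le> w"
      using card_same_rank[of 0] by linarith
    moreover have "real w \<le> gr * w" using gr_bounds mult_right_mono[of 1 gr "real w"] by simp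
    ultimately show ?thesis by linarith
  next
    case True
    obtain x where tx: "tight x" and mx: "\<And>b. tight b \<Longrightarrow> r b \<le> r x"
    proof -
      have "finite {x. tight x}" unfolding tight_def by auto
      moreover have "{x. tight x} \<noteq> {}" using True by auto
      ultimately have "Max (r ` {x. tight x}) \<in> r ` {x. tight x}" by (intro Max_in) auto
      then obtain x where "tight x" "r x = Max (r ` {x. tight x})" by auto
      then show ?thesis using that \<open>finite {x. tight x}\<close> by (metis Max_ge finite_imageI imageI mem_Collect_eq)
    qed
    have x: "x < n" "D x \<noteq> {}" "\<And>d. d \<in> D x \<Longrightarrow> used d" "r x0 \<le> r x"
      and x_pr: "\<And>j. pr x = Some j \<Longrightarrow> \<exists>s\<in>D x. r j < r s" using tx unfolding tight_def by auto
    define d where "d = Max (r ` D x)"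
    have d_ge: "r q \<le> d" if "q \<in> D x" for q unfolding d_def using that fin_D by auto
    have "d \<in> r ` D x" unfolding d_def using x(2) fin_D by (intro Max_in) auto
    then obtain s0 where s0: "s0 \<in> D x" "r s0 = d" by auto
    \<comment> \<open>\<open>A\<close>, \<open>V\<close> and \<open>B\<close> are consecutive rank
      intervals, cut at \<open>d\<close> and at \<open>r x\<close>; \<open>S\<close> is the part of
      the class \<open>A\<close> that lies below \<open>x\<close>.\<close>
    define S where "S = {s\<in>D x. r s = d}"
    define A where "A = {a. a < n \<and> r a = d}"
    define V where "V = {v. v < n \<and> d < r v \<and> r v \<le> r x}"
    define B where "B = {b. b < n \<and> r x < r b}"
    define V0 where "V0 = {v\<in>V. \<exists>s\<in>S. pr v = Some s}"
    define Y where "Y = {b\<in>B. \<exists>s\<in>S. pr b = Some s}"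
    define rk where "rk v = card (D v \<inter> S)" for v
    have fin: "finite S" "finite A" "finite V" "finite B" "finite V0" "finite Y"
      unfolding S_def A_def V_def B_def V0_def Y_def using fin_D by auto
    have SA: "S \<subseteq> A" unfolding S_def A_def using D_lt by auto
    have low: "p \<in> D x" if "p < n" "r p < d" for p
      using below[of p s0 x] that s0 x(1) unfolding D_def by auto
    have DV: "D v \<subseteq> D x" if "v \<in> V" for v using that r_le x(1) unfolding V_def by auto
    have DB: "D x \<subseteq> D b" if "b \<in> B" for b using that r_le x(1) unfolding B_def by auto
    have x0_top: "\<not> P b q" if "r x0 < r b" "b < n" "q < n" for b q
      using below[OF x0 that(2,3,1)] x0_max[OF that(3)] by blast
    have B_top: "\<not> P b q" if "b \<in> B" "q < n" for b q
      using x0_top[of b q] that x(4) unfolding B_def by auto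
    have V_disj: "v \<notin> D x" if "v \<in> V" for v using d_ge that unfolding V_def by force
    have VB: "V \<inter> B = {}" unfolding V_def B_def by auto
    \<comment> \<open>Otherwise \<open>b\<close> would be tight with rank above that of
      \<open>x\<close>: points of \<open>D b\<close> in \<open>D x\<close> have successors because
      \<open>x\<close> is tight, and the others have rank at least \<open>d\<close>, so best fit
      would have taken one of them had it been available.\<close>
    have B_pr: "\<exists>j. pr b = Some j \<and> d \<le> r j" if b: "b \<in> B" for b
    proof (rule ccontr)
      assume no: "\<not> ?thesis"
      have bn: "b < n" "r x < r b" using b unfolding B_def by auto
      have "used i" if i: "i \<in> D b" for i
      proof (cases "i \<in> D x")
        case False
        have i': "i < n" "P i b" using i unfolding D_def by auto
        have ri: "d \<le> r i" using low[OF i'(1)] False by force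
        have "\<exists>b'<b. pr b' = Some i"
        proof (cases "pr b")
          case None then show ?thesis using pr_None bn i' by blast
        next
          case (Some j)
          then have "r j < r i" using no ri by force
          then show ?thesis using pr_best[OF bn(1) i'(1) Some i'(2)] unfolding r_def D_def by blast
        qed
        then show ?thesis unfolding used_def using bn by (metis less_trans)
      qed (use x in auto)
      moreover have "\<exists>s\<in>D b. r j < r s" if "pr b = Some j" for j
        using s0 DB[OF b] no that by (intro bexI[of _ s0]) auto
      moreover have "D b \<noteq> {}" using DB[OF b] x(2) by auto
      ultimately have "tight b" unfolding tight_def using bn x(4) by auto
      then show False using mx bn by fastforce
    qed
    have user: "b \<in> V0 \<union> Y" if "b < n" "pr b = Some s" "s \<in> S" for b s
    proof -
      have "r s < r b" using P_r pr_below that by blast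
      then have "b \<in> V \<or> b \<in> B" using that unfolding V_def B_def S_def by auto
      then show ?thesis using that unfolding V0_def Y_def by auto
    qed
    have V0Y: "V0 \<union> Y \<subseteq> {..<n}" unfolding V0_def Y_def V_def B_def by auto
    have card_S: "card S = card V0 + card Y"
    proof -
      have "inj_on (\<lambda>b. the (pr b)) (V0 \<union> Y)"
      proof (rule inj_onI)
        fix a b assume ab: "a \<in> V0 \<union> Y" "b \<in> V0 \<union> Y" "the (pr a) = the (pr b)"
        then obtain s t where "pr a = Some s" "pr b = Some t" unfolding V0_def Y_def by auto
        moreover have "a < n" "b < n" using ab(1,2) V0Y by auto
        ultimately show "a = b" using ab(3) pr_inj by auto
      qed
      moreover have "(\<lambda>b. the (pr b)) ` (V0 \<union> Y) = S"
      proof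
        show "(\<lambda>b. the (pr b)) ` (V0 \<union> Y) \<subseteq> S" unfolding V0_def Y_def by auto
        show "S \<subseteq> (\<lambda>b. the (pr b)) ` (V0 \<union> Y)"
        proof
          fix s assume s: "s \<in> S"
          then obtain b where b: "b < n" "pr b = Some s" using x(3) unfolding S_def used_def by auto
          then show "s \<in> (\<lambda>b. the (pr b)) ` (V0 \<union> Y)" using user[OF b s] by force
        qed
      qed
      ultimately have "card S = card (V0 \<union> Y)" by (metis card_image)
      also have "\<dots> = card V0 + card Y"
        by (rule card_Un_disjoint) (use fin VB in \<open>auto simp: V0_def Y_def\<close>)
      finally show ?thesis .
    qed
    define \<sigma> where "\<sigma> = w - card A"
    have Aw: "card A + \<sigma> = w" using card_same_rank[of d] unfolding A_def \<sigma>_def by simp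
    have anti: "card (X \<union> Z) \<le> w" if XA: "X \<subseteq> A" and ZV: "Z \<subseteq> V" and XZ: "\<And>s v. s \<in> X \<Longrightarrow> v \<in> Z \<Longrightarrow> \<not> P s v" for X Z
    proof (rule width)
      show "X \<union> Z \<subseteq> {..<n}" using XA ZV unfolding A_def V_def by auto
      have "\<not> P p q" if p: "p \<in> X \<union> Z" and q: "q \<in> X \<union> Z" for p q
      proof
        assume P: "P p q"
        have pq: "p < n" "q < n" "d \<le> r p" using p q XA ZV unfolding A_def V_def by auto
        then have "d < r q" using P_r[OF pq(1,2) P] by simp
        then have qZ: "q \<in> Z" using q XA unfolding A_def by auto
        then have "p \<in> D x" using DV[of q] ZV P pq unfolding D_def by auto
        then have "p \<in> X" using p V_disj ZV by auto
          then show False using XZ qZ P by blast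
      qed
      then show "antichain P (X \<union> Z)" unfolding antichain_def by auto
    qed
    have AV: "A \<inter> V = {}" unfolding A_def V_def by auto
    have TV: "card (A - S) + card V \<le> w"
    proof -
      have "card ((A - S) \<union> V) \<le> w"
      proof (rule anti)
        fix s v assume "s \<in> A - S" "v \<in> V"
        then show "\<not> P s v" using DV[of v] unfolding S_def A_def D_def by auto
      qed auto
      then show ?thesis using AV fin by (subst (asm) card_Un_disjoint) auto
    qed
    have rk_r: "r v < r u" if "u < n" "v < n" "rk v < rk u" for u v
    proof (rule ccontr)
      assume "\<not> r v < r u"
      then have "D u \<subseteq> D v" using that r_le by auto
      then have "rk u \<le> rk v" unfolding rk_def using fin by (intro card_mono) auto
      then show False using that by simp
    qed
    interpret TL: two_layer P V B Y V0 rk pr w \<sigma> n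
    proof
      show "finite V" "finite B" "Y \<subseteq> B" "V0 \<subseteq> V" using fin unfolding Y_def V0_def by auto
    next
      fix X C assume XC: "X \<subseteq> V" "C \<subseteq> B" "\<forall>x\<in>X. \<forall>b\<in>C. \<not> P x b"
      have "card (X \<union> C) \<le> w"
      proof (rule width)
        show "X \<union> C \<subseteq> {..<n}" using XC unfolding V_def B_def by auto
        have "\<not> P p q" if p: "p \<in> X \<union> C" and q: "q \<in> X \<union> C" for p q
        proof
          assume P: "P p q"
          have pq: "p < n" "q < n" using p q XC(1,2) unfolding V_def B_def by auto
          then have pX: "p \<in> X" using B_top[of p q] p P XC(2) by auto
          then have "q \<in> X" using q P XC(3) by auto
          then have "p \<in> D x" using DV[of q] XC(1) P pq unfolding D_def by auto
          then show False using V_disj XC(1) pX by auto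
        qed
        then show "antichain P (X \<union> C)" unfolding antichain_def by auto
      qed
      moreover have "card (X \<union> C) = card X + card C"
        by (rule card_Un_disjoint) (use XC VB fin finite_subset in \<open>blast+\<close>)
      ultimately show "card X + card C \<le> w" by simp
    next
      fix b b' assume "b \<in> B" "b' \<in> B"
      then show "(\<forall>v\<in>V. P v b \<longrightarrow> P v b') \<or> (\<forall>v\<in>V. P v b' \<longrightarrow> P v b)"
        using D_nested[of b b'] unfolding B_def D_def V_def by blast
    next
      fix u v b assume "u \<in> V" "v \<in> V" "b \<in> B" "rk v < rk u" "P u b"
      then show "P v b" using below[of v u b] rk_r[of u v] unfolding V_def B_def by auto
    next
      fix v b assume "v \<in> V" "b \<in> B" "P v b"
      then show "v < b" using up unfolding V_def B_def by auto
    next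
      fix b assume "b \<in> B" then show "b < n" unfolding B_def by auto
    next
      fix v b assume "v \<in> V" "b \<in> B" "pr b = Some v"
      then show "P v b" using pr_below unfolding B_def by auto
    next
      fix v b b' assume "b \<in> B" "b' \<in> B" "pr b = Some v" "pr b' = Some v"
      then show "b = b'" using pr_inj unfolding B_def by auto
    next
      fix v b
      assume v: "v \<in> V" and b: "b \<in> B" and P: "P v b"
        and less: "\<And>u. u \<in> V \<Longrightarrow> pr b = Some u \<Longrightarrow> rk u < rk v"
      have vb: "v < n" "b < n" "d < r v" using v b unfolding V_def B_def by auto
      obtain j where j: "pr b = Some j" "d \<le> r j" using B_pr[OF b] by auto
      have jn: "j < n" "P j b" using pr_below j vb by auto
      have "r j < r v"
      proof (cases "j \<in> V")
        case True
        then show ?thesis using less j rk_r[of v j] vb jn by auto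
      next
        case False
        then have "r j = d" using B_top[of j b] j jn vb unfolding V_def B_def by auto
        then show ?thesis using vb by simp
      qed
      then obtain b' where b': "b' < b" "pr b' = Some v"
        using pr_best[OF vb(2,1) j(1) P] unfolding r_def D_def by blast
      have b'n: "b' < n" using b' vb by simp
      have "v \<in> D b'" using pr_below[OF b'n b'(2)] unfolding D_def by auto
      then have "b' \<in> B" using V_disj[OF v] r_less_iff[of x b'] b'n x(1) unfolding B_def by auto
      then show "\<exists>b'\<in>B. b' < b \<and> pr b' = Some v" using b' by auto
    next
      fix b v assume "b \<in> Y" "pr b = Some v"
      then show "v \<notin> V" unfolding Y_def S_def V_def by auto
    next
      fix v assume v: "v \<in> V - V0"
      then have vn: "v < n" unfolding V_def by auto
      \<comment> \<open>As \<open>v\<close> is not in \<open>V0\<close>, it has no predecessor or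
        one of rank below \<open>d\<close>. So every point of \<open>S\<close> below
        \<open>v\<close> already had a successor when \<open>v\<close> arrived, and successors of
        \<open>S\<close> lie in \<open>V0\<close> or \<open>Y\<close>.\<close>
      have "D v \<inter> S \<subseteq> (\<lambda>b. the (pr b)) ` ({b\<in>Y. b < v} \<union> V0)"
      proof
        fix s assume s: "s \<in> D v \<inter> S"
        then have s': "s < n" "P s v" "r s = d" unfolding D_def S_def by auto
        have "\<exists>b'<v. pr b' = Some s"
        proof (cases "pr v")
          case None then show ?thesis using pr_None vn s' by blast
        next
          case (Some j)
          have "j < n" "P j v" using pr_below[OF vn Some] by auto
          then have "j \<in> D x" using DV[of v] v unfolding D_def by auto
          moreover have "j \<notin> S" using v Some unfolding V0_def by auto
          ultimately have "r j < r s" using d_ge[of j] s'(3) unfolding S_def by force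
          then show ?thesis using pr_best[OF vn s'(1) Some s'(2)] unfolding r_def D_def by blast
        qed
        then obtain b' where b': "b' < v" "pr b' = Some s" by auto
        then have "b' \<in> V0 \<union> Y" using user[of b' s] s vn by auto
        then show "s \<in> (\<lambda>b. the (pr b)) ` ({b\<in>Y. b < v} \<union> V0)" using b' by force
      qed
      then have "card (D v \<inter> S) \<le> card ({b\<in>Y. b < v} \<union> V0)"
        using fin by (intro surj_card_le) auto
      then show "rk v \<le> card {b\<in>Y. b < v} + card V0"
        unfolding rk_def using card_Un_le le_trans by blast
    next
      fix \<theta>
      let ?X = "{v\<in>V. rk v \<le> \<theta>}"
      show "card ?X \<le> \<theta> + \<sigma>"
      proof (cases "?X = {}")
        case True
        show ?thesis unfolding True by simp
      next
        case False
        have "finite ?X" using fin by auto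
        then have "Max (r ` ?X) \<in> r ` ?X" using False by (intro Max_in) auto
        \<comment> \<open>All points of the set have their down sets inside that of the highest one,
          \<open>v\<close>. Hence they form an antichain with the points of \<open>A\<close> not
          below \<open>v\<close>.\<close>
        then obtain v where v: "v \<in> V" "rk v \<le> \<theta>" "r v = Max (r ` ?X)" by auto
        have le: "r u \<le> r v" if "u \<in> ?X" for u using v(3) that \<open>finite ?X\<close> by simp
        have "card ((A - D v \<inter> S) \<union> ?X) \<le> w"
        proof (rule anti)
          fix s u assume s: "s \<in> A - D v \<inter> S" and u: "u \<in> ?X"
          have uv: "u < n" "v < n" using u v unfolding V_def by auto
          show "\<not> P s u"
          proof
            assume "P s u"
            then have "s \<in> D u" using s unfolding A_def D_def by auto
            moreover have "D u \<subseteq> D v" using r_le[OF uv le[OF u]] .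
            ultimately show False using s DV[OF v(1)] unfolding S_def A_def by auto
          qed
        qed auto
        moreover have "card ((A - D v \<inter> S) \<union> ?X) = card (A - D v \<inter> S) + card ?X"
          using AV fin by (intro card_Un_disjoint) auto
        moreover have "card (A - D v \<inter> S) = card A - rk v"
          unfolding rk_def using fin SA by (intro card_Diff_subset) auto
        moreover have "rk v \<le> card A" unfolding rk_def using fin SA by (intro card_mono) auto
        ultimately show ?thesis using v(2) Aw by linarith
      qed
    next
      have "d < r x" using P_r[of s0 x] s0 x(1) unfolding D_def by auto
      then have "x \<in> V" using x(1) unfolding V_def by auto
      moreover have "x \<notin> V0" using x_pr d_ge unfolding V0_def S_def by fastforce
      moreover have "rk v \<le> rk x" if "v \<in> V" for v
        unfolding rk_def using fin DV[OF that] by (intro card_mono) auto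
      ultimately show "\<exists>x\<in>V - V0. \<forall>v\<in>V. rk v \<le> rk x" by auto
    next
      fix v assume "v \<in> V" then show "v < n" unfolding V_def by auto
    qed
    \<comment> \<open>Count chain entries into the set of points of rank at least \<open>d\<close>.
      Points of \<open>B\<close> (by \<open>B_pr\<close>) and of \<open>V0\<close> have their
      predecessor in this set, so only \<open>A\<close> and \<open>V - V0\<close>
      contribute.\<close>
    have N: "card {k. k < n \<and> pr k = None} \<le> card A + card (V - V0)"
    proof -
      define Q where "Q = {p. p < n \<and> d \<le> r p}"
      have Q: "Q = A \<union> V \<union> B" unfolding Q_def A_def V_def B_def
        using P_r[of s0 x] s0 x(1) unfolding D_def by auto
      have "card {k. k < n \<and> pr k = None} \<le> card {k\<in>Q. \<forall>j\<in>Q. pr k \<noteq> Some j}"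
      proof (rule openers_le)
        show "Q \<subseteq> {..<n}" unfolding Q_def by auto
        show "i \<in> Q" if "i < n" "\<not> used i" for i
          using low[of i] x(3) that unfolding Q_def by force
        show "b \<in> Q" if "b < n" "pr b = Some j" "j \<in> Q" for b j
          using P_r[of j b] pr_below[OF that(1,2)] that unfolding Q_def by auto
      qed
      also have "\<dots> \<le> card (A \<union> (V - V0))"
      proof (rule card_mono)
        show "finite (A \<union> (V - V0))" using fin by auto
        have "\<exists>j\<in>Q. pr k = Some j" if "k \<in> B" for k
          using B_pr[OF that] pr_below that unfolding Q_def B_def by blast
        moreover have "\<exists>j\<in>Q. pr k = Some j" if "k \<in> V0" for k
          using that SA unfolding V0_def Q by auto
        ultimately show "{k\<in>Q. \<forall>j\<in>Q. pr k \<noteq> Some j} \<subseteq> A \<union> (V - V0)"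
          unfolding Q by blast
      qed
      also have "\<dots> \<le> card A + card (V - V0)" by (rule card_Un_le)
      finally show ?thesis .
    qed
    have VV0: "card (V - V0) + card V0 = card V"
      using fin TL.V0_sub card_Diff_subset[of V0 V] card_mono[of V V0] by auto
    have "card (A - S) + card S = card A"
      using fin SA card_Diff_subset[of S A] card_mono[of A S] by auto
    then have Y: "card V \<le> card Y + \<sigma> + card V0" using card_S TV Aw by linarith
    define o' \<mu> v Y' s v0 where "o' = real (card {k. k < n \<and> pr k = None})" and "\<mu> = o' - w"
      and "v = real (card V)" and "Y' = real (card Y)" and "s = real \<sigma>" and "v0 = real (card V0)"
    note defs = o'_def v_def Y'_def s_def v0_def
    have e1: "\<mu> \<le> v - v0 - s" unfolding \<mu>_def defs using N VV0 Aw by linarith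
    have e2: "v \<le> Y' + s + v0" unfolding defs using Y by linarith
    have e3: "gr * (Y' - (w - v)) \<le> w - v + 2 * v0 + s"
      using TL.golden_bound unfolding defs by simp
    \<comment> \<open>Eliminate \<open>Y'\<close> by \<open>e2\<close> to bound \<open>v\<close>
      from \<open>e3\<close>, then pass to the excess \<open>\<mu>\<close> by \<open>e1\<close>. The
      terms in \<open>v0\<close> and \<open>s\<close> end up with the favourable sign, and what
      remains is the factor gr - 1.\<close>
    have "gr * (2 * v - s - v0 - w) \<le> gr * (Y' - (w - v))"
      using e2 gr_bounds by (intro mult_left_mono) auto
    then have "(2 * gr + 1) * v \<le> (gr + 1) * w + (2 + gr) * v0 + (1 + gr) * s"
      using e3 by (simp add: algebra_simps)
    moreover have "(2 * gr + 1) * (\<mu> + s + v0) \<le> (2 * gr + 1) * v"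
      using e1 gr_bounds by (intro mult_left_mono) auto
    moreover have "0 \<le> (gr - 1) * v0" "0 \<le> gr * s"
      using gr_bounds unfolding defs by auto
    ultimately have "(2 * gr + 1) * \<mu> \<le> (gr + 1) * w" by (simp add: algebra_simps)
    also have "gr + 1 = (2 * gr + 1) * (gr - 1)" using gr_sq by (simp add: algebra_simps)
    finally have "(2 * gr + 1) * \<mu> \<le> (2 * gr + 1) * ((gr - 1) * w)" by (simp add: mult.assoc)
    then have "\<mu> \<le> (gr - 1) * w" using gr_bounds by simp
    then show ?thesis unfolding \<mu>_def o'_def by (simp add: algebra_simps)
  qed
qed

end


section \<open>Best fit as an on-line algorithm\<close>

lemma finite_antichain_cards: "finite {card S | S. S \<subseteq> {..<n} \<and> antichain P S}"
proof -
  have "{card S | S. S \<subseteq> {..<n} \<and> antichain P S} \<subseteq> card ` Pow {..<n}" by auto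
  then show ?thesis using finite_subset by blast
qed

lemma card_le_width: "S \<subseteq> {..<n} \<Longrightarrow> antichain P S \<Longrightarrow> card S \<le> width n P"
  unfolding width_def by (rule Max_ge[OF finite_antichain_cards]) auto

definition tops :: "(nat \<Rightarrow> nat \<Rightarrow> bool) \<Rightarrow> nat \<Rightarrow> (nat \<Rightarrow> nat option) \<Rightarrow> nat set" where
  "tops P k s = {j. j < k \<and> P j k \<and> (\<forall>b<k. s b \<noteq> Some j)}"

text \<open>Down sets are measured among points presented before the candidate, so the choice
  depends on the seen order only. In an up-growing order this is the full down set.\<close>

definition best_top :: "(nat \<Rightarrow> nat \<Rightarrow> bool) \<Rightarrow> nat \<Rightarrow> (nat \<Rightarrow> nat option) \<Rightarrow> nat option" where
  "best_top P k s = (if tops P k s = {} then None else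
     Some (SOME j. j \<in> tops P k s \<and>
       (\<forall>i\<in>tops P k s. card {q. q < i \<and> P q i} \<le> card {q. q < j \<and> P q j})))"

primrec preds :: "(nat \<Rightarrow> nat \<Rightarrow> bool) \<Rightarrow> nat \<Rightarrow> nat \<Rightarrow> nat option" where
  "preds P 0 = (\<lambda>_. None)"
| "preds P (Suc k) = (preds P k)(k := best_top P k (preds P k))"

definition chain_pred :: "(nat \<Rightarrow> nat \<Rightarrow> bool) \<Rightarrow> nat \<Rightarrow> nat option" where
  "chain_pred P k = preds P (Suc k) k"

text \<open>A chain is labelled by its first point.\<close>

fun chain_root :: "(nat \<Rightarrow> nat \<Rightarrow> bool) \<Rightarrow> nat \<Rightarrow> nat" where
  "chain_root P k =
     (case chain_pred P k of None \<Rightarrow> k | Some j \<Rightarrow> if j < k then chain_root P j else k)"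

declare chain_root.simps [simp del]

lemma preds_eq: "preds P m i = (if i < m then chain_pred P i else None)"
  by (induction m) (auto simp: chain_pred_def less_Suc_eq)

lemma chain_pred_eq: "chain_pred P k = best_top P k (\<lambda>i. if i < k then chain_pred P i else None)"
proof -
  have "preds P k = (\<lambda>i. if i < k then chain_pred P i else None)" by (rule ext) (simp add: preds_eq)
  then show ?thesis unfolding chain_pred_def by simp
qed

lemma best_top_cong:
  assumes "\<And>x y. x \<le> k \<Longrightarrow> y \<le> k \<Longrightarrow> P x y = Q x y"
  shows "best_top P k s = best_top Q k s"
proof -
  have t: "tops P k s = tops Q k s" unfolding tops_def using assms by auto
  have "card {q. q < i \<and> P q i} = card {q. q < i \<and> Q q i}" if "i \<in> tops Q k s" for i
    using assms that by (intro arg_cong[where f = card]) (auto simp: tops_def)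
  then show ?thesis unfolding best_top_def t by (metis (no_types, lifting))
qed

lemma preds_cong:
  assumes "\<And>x y. x \<le> k \<Longrightarrow> y \<le> k \<Longrightarrow> P x y = Q x y"
  shows "m \<le> Suc k \<Longrightarrow> preds P m = preds Q m"
proof (induction m)
  case (Suc m)
  have "best_top P m (preds P m) = best_top Q m (preds P m)"
    by (rule best_top_cong) (use assms Suc.prems in auto)
  then show ?case using Suc by simp
qed simp

lemma online_chain_root: "online chain_root"
  unfolding online_def
proof (intro allI impI)
  fix P Q :: "nat \<Rightarrow> nat \<Rightarrow> bool" and k
  show "\<forall>x\<le>k. \<forall>y\<le>k. P x y = Q x y \<Longrightarrow> chain_root P k = chain_root Q k"
  proof (induction k rule: less_induct)
    case (less k)
    have "chain_pred P k = chain_pred Q k"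
      unfolding chain_pred_def using preds_cong[of k P Q "Suc k"] less.prems by simp
    then show ?case
      using less by (auto simp: chain_root.simps[of P k] chain_root.simps[of Q k] split: option.split)
  qed
qed

lemma best_top_Some:
  assumes "best_top P k s = Some j"
  shows "j \<in> tops P k s"
    and "i \<in> tops P k s \<Longrightarrow> card {q. q < i \<and> P q i} \<le> card {q. q < j \<and> P q j}"
proof -
  let ?r = "\<lambda>i. card {q. q < i \<and> P q i}"
  have ne: "tops P k s \<noteq> {}" using assms unfolding best_top_def by (auto split: if_splits)
  have fin: "finite (tops P k s)" unfolding tops_def by auto
  have "Max (?r ` tops P k s) \<in> ?r ` tops P k s" using ne fin by (intro Max_in) auto
  then obtain m where m: "m \<in> tops P k s" "?r m = Max (?r ` tops P k s)" by auto
  then have "\<exists>j. j \<in> tops P k s \<and> (\<forall>i\<in>tops P k s. ?r i \<le> ?r j)"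
    using fin by (intro exI[of _ m]) auto
  from someI_ex[OF this] assms ne
  show "j \<in> tops P k s" "i \<in> tops P k s \<Longrightarrow> ?r i \<le> ?r j"
    unfolding best_top_def by auto
qed

lemma chain_pred_Some:
  assumes "chain_pred P k = Some j"
  shows "j < k" "P j k" "\<And>b. b < k \<Longrightarrow> chain_pred P b \<noteq> Some j"
    "\<And>i. i < k \<Longrightarrow> P i k \<Longrightarrow> (\<And>b. b < k \<Longrightarrow> chain_pred P b \<noteq> Some i) \<Longrightarrow>
      card {q. q < i \<and> P q i} \<le> card {q. q < j \<and> P q j}"
proof -
  note b = best_top_Some[OF assms[unfolded chain_pred_eq[of P k]]]
  show "j < k" "P j k" "\<And>b. b < k \<Longrightarrow> chain_pred P b \<noteq> Some j"
    using b(1) unfolding tops_def by auto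
  show "card {q. q < i \<and> P q i} \<le> card {q. q < j \<and> P q j}"
    if "i < k" "P i k" "\<And>b. b < k \<Longrightarrow> chain_pred P b \<noteq> Some i" for i
    by (rule b(2)) (use that in \<open>auto simp: tops_def\<close>)
qed

lemma chain_pred_None:
  assumes "chain_pred P k = None" "i < k" "P i k"
  shows "\<exists>b<k. chain_pred P b = Some i"
  using assms(1)[unfolded chain_pred_eq[of P k]] assms(2,3)
  by (auto simp: best_top_def tops_def split: if_splits)

lemma chain_pred_inj: "chain_pred P b = Some j \<Longrightarrow> chain_pred P b' = Some j \<Longrightarrow> b = b'"
  using chain_pred_Some(3) by (metis linorder_neqE_nat)

lemma chain_root_None: "chain_pred P k = None \<Longrightarrow> chain_root P k = k"
  and chain_root_Some: "chain_pred P k = Some j \<Longrightarrow> chain_root P k = chain_root P j"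
  using chain_pred_Some(1) by (auto simp: chain_root.simps[of P k])

lemma chain_root_le: "chain_root P k \<le> k"
proof (induction k rule: less_induct)
  case (less k)
  then show ?case
    by (cases "chain_pred P k")
      (auto simp: chain_root_None chain_root_Some dest!: chain_pred_Some(1) intro: le_trans less_imp_le)
qed

lemma chain_pred_root: "chain_pred P (chain_root P k) = None"
proof (induction k rule: less_induct)
  case (less k)
  then show ?case
    by (cases "chain_pred P k") (auto simp: chain_root_None chain_root_Some chain_pred_Some(1))
qed

text \<open>The way down from \<open>x\<close> must pass through \<open>j\<close>. If it stepped
  from \<open>x\<close> to some \<open>j'\<close> before \<open>j\<close>, then by induction
  \<open>j'\<close> would have a second successor on the way down from \<open>j\<close>, against
  injectivity of \<open>chain_pred\<close>.\<close>

lemma same_root_used: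
  "j < x \<Longrightarrow> chain_root P j = chain_root P x \<Longrightarrow> \<exists>i\<le>x. chain_pred P i = Some j"
proof (induction x arbitrary: j rule: less_induct)
  case (less x)
  show ?case
  proof (cases "chain_pred P x")
    case None
    then show ?thesis using less.prems chain_root_None chain_root_le[of P j] by simp
  next
    case (Some j')
    have j': "j' < x" "chain_root P j' = chain_root P x"
      using chain_pred_Some(1)[OF Some] chain_root_Some[OF Some] by auto
    consider "j' = j" | "j < j'" | "j' < j" by linarith
    then show ?thesis
    proof cases
      case 1 then show ?thesis using Some by blast
    next
      case 2
      then show ?thesis using less.IH[OF j'(1) 2] less.prems j' by (metis le_trans less_imp_le)
    next
      case 3
      then obtain i where "i \<le> j" "chain_pred P i = Some j'"
        using less.IH[OF less.prems(1) 3] less.prems j' by auto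
      then show ?thesis using chain_pred_inj[OF Some] less.prems(1) by force
    qed
  qed
qed

lemma same_root_below:
  assumes trans: "\<And>x y z. x < n \<Longrightarrow> y < n \<Longrightarrow> z < n \<Longrightarrow> P x y \<Longrightarrow> P y z \<Longrightarrow> P x z"
  shows "x < y \<Longrightarrow> y < n \<Longrightarrow> chain_root P x = chain_root P y \<Longrightarrow> P x y"
proof (induction y rule: less_induct)
  case (less y)
  show ?case
  proof (cases "chain_pred P y")
    case None
    then show ?thesis using less.prems chain_root_None chain_root_le[of P x] by simp
  next
    case (Some j)
    note j = chain_pred_Some(1,2)[OF Some] chain_root_Some[OF Some]
    consider "j = x" | "x < j" | "j < x" by linarith
    then show ?thesis
    proof cases
      case 1 then show ?thesis using j by simp
    next
      case 2
      then have "P x j" using less.IH[OF j(1) 2] less.prems j by simp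
      then show ?thesis using trans[of x j y] j less.prems by simp
    next
      case 3
      then obtain i where "i \<le> x" "chain_pred P i = Some j"
        using same_root_used[of j x P] less.prems(3) j(3) by auto
      then show ?thesis using chain_pred_inj[OF Some] less.prems(1) by force
    qed
  qed
qed

text \<open>All prefixes are covered, because the bound on openers is applied to the prefix that
  ends with the last opener.\<close>

lemma best_fit_run_chain_pred:
  assumes "valid_input w n P"
  obtains f where "\<And>m. m \<le> n \<Longrightarrow> best_fit_run m P f (chain_pred P) w"
proof -
  obtain f :: "nat \<Rightarrow> real" where f: "\<And>x y. x < n \<Longrightarrow> y < n \<Longrightarrow> P x y \<longleftrightarrow> f x + 1 < f y"
    using assms unfolding valid_input_def semiorder_def by blast
  have irr: "\<not> P x x" if "x < n" for x using f[OF that that] by simp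
  have up: "x < y" if "x < n" "y < n" "P x y" for x y
    using assms that irr[of x] unfolding valid_input_def up_growing_def by (metis linorder_neqE_nat)
  have "best_fit_run m P f (chain_pred P) w" if m: "m \<le> n" for m
  proof
    show "P x y \<longleftrightarrow> f x + 1 < f y" if "x < m" "y < m" for x y using f that m by simp
    show "x < y" if "x < m" "y < m" "P x y" for x y using up that m by simp
    show "card S \<le> w" if "S \<subseteq> {..<m}" "antichain P S" for S
    proof -
      have "S \<subseteq> {..<n}" using that m by auto
      from card_le_width[OF this that(2)] show ?thesis using assms unfolding valid_input_def by simp
    qed
    show "j < m \<and> P j b" if "b < m" "chain_pred P b = Some j" for b j
      using chain_pred_Some(1,2)[OF that(2)] that(1) by simp
    show "b = b'" if "chain_pred P b = Some j" "chain_pred P b' = Some j" for b b' j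
      using chain_pred_inj that by blast
    have D: "{q. q < m \<and> P q i} = {q. q < i \<and> P q i}" if "i < m" for i
      using up m that by (auto intro: less_trans)
    show "\<exists>b'<b. chain_pred P b' = Some i"
      if b: "b < m" and i: "i < m" and j: "chain_pred P b = Some j" and P: "P i b"
        and less: "card {q. q < m \<and> P q j} < card {q. q < m \<and> P q i}" for b j i
    proof (rule ccontr)
      assume no: "\<not> ?thesis"
      have "i < b" using up b i P m by simp
      then have "card {q. q < i \<and> P q i} \<le> card {q. q < j \<and> P q j}"
        using chain_pred_Some(4)[OF j] P no by blast
      then show False using less D[OF i] D[of j] chain_pred_Some(1)[OF j] b by simp
    qed
    show "\<exists>b'<b. chain_pred P b' = Some i"
      if "b < m" "i < m" "chain_pred P b = None" "P i b" for b i
      using chain_pred_None[OF that(3) _ that(4)] up[of i b] that m by simp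
  qed
  then show ?thesis using that by blast
qed

theorem best_fit_chains:
  assumes "valid_input w n P"
  shows "chain_partition n P (chain_root P)"
    and "int (chains_used n (chain_root P)) \<le> \<lfloor>gr * real w\<rfloor>"
proof -
  obtain f where run: "\<And>m. m \<le> n \<Longrightarrow> best_fit_run m P f (chain_pred P) w"
    using best_fit_run_chain_pred[OF assms] by blast
  note trans = best_fit_run.P_trans[OF run[OF order_refl]]
  have "P x y \<or> P y x" if "x < n" "y < n" "x \<noteq> y" "chain_root P x = chain_root P y" for x y
    using same_root_below[of n P x y] same_root_below[of n P y x] trans that
    by (metis linorder_neqE_nat)
  then show "chain_partition n P (chain_root P)" unfolding chain_partition_def by auto
  let ?O = "\<lambda>m. {k. k < m \<and> chain_pred P k = None}"
  have "chain_root P ` {..<n} \<subseteq> ?O n"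
    using chain_root_le chain_pred_root by (auto intro: le_less_trans)
  then have c: "chains_used n (chain_root P) \<le> card (?O n)"
    unfolding chains_used_def by (intro card_mono) auto
  have "real (card (?O n)) \<le> gr * w"
  proof (cases "?O n = {}")
    case True
    show ?thesis unfolding True using gr_bounds by simp
  next
    case False
    define x0 where "x0 = Max (?O n)"
    have "x0 \<in> ?O n" unfolding x0_def using False by (intro Max_in) auto
    then have x0: "x0 < n" "chain_pred P x0 = None" by auto
    have "?O n = ?O (Suc x0)"
      using x0(1) by (auto simp: x0_def less_Suc_eq_le intro!: Max_ge)
    then show ?thesis
      using best_fit_run.openers_bound[OF run[of "Suc x0"] refl x0(2)] x0(1) by simp
  qed
  then show "int (chains_used n (chain_root P)) \<le> \<lfloor>gr * real w\<rfloor>"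
    using c by (simp add: le_floor_iff)
qed


section \<open>Lower bound: Spoiler's strategy\<close>

locale spoiler =
  fixes A :: "(nat \<Rightarrow> nat \<Rightarrow> bool) \<Rightarrow> nat \<Rightarrow> nat" and w m :: nat
  assumes online: "online A" and m_le: "m \<le> w"

text \<open>
  The layers are \<open>{..<w}\<close>, \<open>L1\<close> and \<open>L2\<close>; adjacent layers are compared through the keys \<open>g\<close>.
  \<open>M\<close> is the set of marked points, \<open>i\<close> the number of blocks, and \<open>E\<close> the set of top points that start
  a run. An unmarked point of block \<open>l\<close> has key \<open>2 * l + 1\<close>. When top point \<open>n\<close> marks it, the key drops to
  \<open>2 * l + 1 - 1 / (n + 2)\<close>, just below the key of the top point \<open>n + 1\<close> that follows; later marks in
  the block are higher. So changing a key never changes the order presented so far.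
\<close>

locale position = spoiler +
  fixes n :: nat and P :: "nat \<Rightarrow> nat \<Rightarrow> bool" and L1 L2 E M :: "nat set"
    and g :: "nat \<Rightarrow> real" and i :: nat
  assumes w_le: "w \<le> n"
    and layers: "L1 \<union> L2 = {w..<n}" "L1 \<inter> L2 = {}"
    and P_iff: "\<And>x y. P x y \<longleftrightarrow> x < w \<and> y \<in> L1 \<and> g x < g y \<or> x < w \<and> y \<in> L2
        \<or> x \<in> L1 \<and> y \<in> L2 \<and> g x < g y"
    and order: "\<And>x y. x \<in> L1 \<Longrightarrow> y \<in> L2 \<Longrightarrow> g x < g y \<Longrightarrow> x < y"
    and E_sub: "E \<subseteq> L2" and M_sub: "M \<subseteq> {..<w} \<union> L1" and card_M: "card M = card L2"
    and g_bottom: "\<And>a. a < w \<Longrightarrow>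
        if a \<in> M then \<exists>t::nat. 1 \<le> t \<and> t \<le> i + 1 \<and> g a = 2 * real t else g a = 2 * real m + 4"
    and g_middle: "\<And>v. v \<in> L1 \<Longrightarrow> \<exists>l::nat. 1 \<le> l \<and> l \<le> i \<and>
        (if v \<in> M then 2 * real l < g v \<and> g v < 2 * real l + 1 else g v = 2 * real l + 1)"
    and g_top: "\<And>b. b \<in> L2 \<Longrightarrow>
        if b \<in> E then \<exists>t::nat. 1 \<le> t \<and> t \<le> i + 1 \<and> g b = 2 * real t
        else \<exists>l::nat. 1 \<le> l \<and> l \<le> i \<and> g b = 2 * real l + 1 - 1 / (real b + 2)"
    and colour: "\<And>x y. chain_partition n P (A P) \<Longrightarrow> P x y \<Longrightarrow> A P x = A P y \<Longrightarrow> x \<in> M"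
    and bottom_count: "\<And>t::nat. 1 \<le> t \<Longrightarrow> t \<le> i \<Longrightarrow>
        card {v\<in>L1. g v < 2 * real t + 2} \<le> card {a. a < w \<and> g a \<le> 2 * real t}"
    and i_le: "i \<le> card L1" and L1_le: "card L1 \<le> m"
begin

lemma fin: "finite L1" "finite L2" "finite E" "finite M"
proof -
  have "finite (L1 \<union> L2)" using layers(1) by simp
  then show "finite L1" "finite L2" by auto
  then show "finite E" "finite M" using E_sub M_sub finite_subset by auto
qed

lemma L_bounds: "x \<in> L1 \<Longrightarrow> w \<le> x \<and> x < n" "x \<in> L2 \<Longrightarrow> w \<le> x \<and> x < n"
  using layers(1) by auto

lemma P_less: "P x y \<Longrightarrow> x < y \<and> y < n"
  using P_iff[of x y] L_bounds(1)[of y] L_bounds(2)[of y] order[of x y] by auto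

text \<open>\<open>st\<close> tells whether the new top point starts a run. Its key lies below those
  of the unmarked points in block \<open>l\<close> (a starter has \<open>l = i + 1\<close>, a block
  not yet present), so the point marked next lies in a strictly lower block or at the
  bottom.\<close>

lemma add_top:
  fixes st :: bool and l :: nat
  assumes unmarked: "\<exists>a<w. a \<notin> M"
    and st: "st \<Longrightarrow> l = i + 1 \<and> g0 = 2 * (real i + 1)"
    and fo: "\<not> st \<Longrightarrow> 1 \<le> l \<and> l \<le> i \<and> g0 = 2 * real l + 1 - 1 / (real n + 2)"
  obtains P' p l' h where "p \<notin> M"
    "position A w m (Suc n) P' L1 (insert n L2) (if st then insert n E else E) (insert p M) (g(n := g0, p := h)) i"
    "p < w \<and> h = 2 * (real i + 1) \<or>
      p \<in> L1 \<and> 1 \<le> l' \<and> l' < l \<and> g p = 2 * real l' + 1 \<and> h = 2 * real l' + 1 - 1 / (real n + 2)"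
proof -
  define P' where "P' x y \<longleftrightarrow> P x y \<or> y = n \<and> (x < w \<or> x \<in> L1 \<and> g x < g0)" for x y
  define good where "good p \<longleftrightarrow> P' p n \<and> p \<notin> M \<and> A P' p = A P' n" for p
  obtain a where a: "a < w" "a \<notin> M" using unmarked by auto
  \<comment> \<open>If Algorithm continues no chain through an unmarked point, an arbitrary unmarked
    bottom point is marked, so that the number of marks still equals the number of top
    points.\<close>
  define p where "p = (if \<exists>q. good q then SOME q. good q else a)"
  have good_p: "good p" if "\<exists>q. good q" using that unfolding p_def by (simp add: someI_ex)
  have nL: "n \<notin> L1" "n \<notin> L2" "\<not> n < w" using L_bounds w_le by auto
  have Pn: "\<not> P x n" "\<not> P n x" for x using P_less[of x n] P_less[of n x] by auto
  have p: "p \<notin> M" "p < w \<or> p \<in> L1 \<and> g p < g0"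
    using good_p a Pn(1) unfolding p_def good_def P'_def by (cases "\<exists>q. good q"; auto)+
  have pn: "p < n" using p(2) L_bounds w_le by auto
  define e where "e = 1 / (real n + 2)"
  have e: "0 < e" "e < 1" unfolding e_def by (auto simp: field_simps)
  have "\<exists>l'. p \<in> L1 \<longrightarrow> 1 \<le> l' \<and> l' \<le> i \<and> g p = 2 * real l' + 1"
    using g_middle[of p] p(1) by auto
  then obtain l' :: nat where l': "p \<in> L1 \<Longrightarrow> 1 \<le> l' \<and> l' \<le> i \<and> g p = 2 * real l' + 1" by auto
  have l'l: "l' < l" if "p \<in> L1"
  proof (cases st)
    case True
    then show ?thesis using l'[OF that] st by auto
  next
    case False
    then have "g0 < 2 * real l + 1" using fo e unfolding e_def by auto
    then show ?thesis using p(2) l'[OF that] that L_bounds(1)[OF that] by auto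
  qed
  \<comment> \<open>A marked bottom point moves just under the future block \<open>i + 1\<close>,
    above the keys of all present blocks, so it is still below no middle point.\<close>
  define h where "h = (if p < w then 2 * (real i + 1) else 2 * real l' + 1 - e)"
  have hw: "h = 2 * (real i + 1)" if "p < w" using that unfolding h_def by simp
  have hL: "h = 2 * real l' + 1 - e" "h < g p" if "p \<in> L1"
    using that L_bounds(1)[OF that] l'[OF that] e unfolding h_def by auto
  define g' where "g' = g(n := g0, p := h)"
  have g'p: "g' p = h" unfolding g'_def by simp
  have g'n: "g' n = g0" unfolding g'_def using pn by simp
  have g'o: "g' x = g x" if "x \<noteq> n" "x \<noteq> p" for x unfolding g'_def using that by simp
  have g'L: "g' v = g v" if "v \<in> L1" "v \<noteq> p" for v using g'o[of v] that nL by blast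
  have g'w: "g' a = g a" if "a < w" "a \<noteq> p" for a using g'o[of a] that nL by blast
  let ?E = "if st then insert n E else E"
  have L1_range: "g v \<le> 2 * real i + 1" if "v \<in> L1" for v
    using g_middle[OF that] by (auto split: if_splits)
  have im: "i \<le> m" using i_le L1_le by simp
  have b_m: "(g' x < g' y) = (g x < g y)" if x: "x < w" and y: "y \<in> L1" for x y
  proof -
    have ne: "x \<noteq> n" "y \<noteq> n" "x \<noteq> y" using x y nL w_le L_bounds(1)[OF y] by auto
    consider "x = p" | "y = p" | "x \<noteq> p" "y \<noteq> p" by blast
    then show ?thesis
    proof cases
      case 1
      have "g x = 2 * real m + 4" using g_bottom[OF x] p(1) 1 by simp
      moreover have "g' x = 2 * (real i + 1)" using g'p hw 1 x by simp
      moreover have "g' y = g y" using g'o ne 1 by simp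
      ultimately show ?thesis using L1_range[OF y] im by simp
    next
      case 2
      have gx: "g' x = g x" using g'o ne 2 by auto
      have gy: "g' y = 2 * real l' + 1 - e" "g y = 2 * real l' + 1" "l' \<le> i"
        using g'p hL l' 2 y by auto
      show ?thesis
      proof (cases "x \<in> M")
        case True
        then obtain t :: nat where "g x = 2 * real t" using g_bottom[OF x] by auto
        then show ?thesis unfolding gx gy using e by (cases "t \<le> l'") auto
      next
        case False
        then have "g x = 2 * real m + 4" using g_bottom[OF x] by simp
        then show ?thesis unfolding gx gy using e gy(3) im by simp
      qed
    next
      case 3 then show ?thesis using g'o ne by simp
    qed
  qed
  have m_t: "(g' x < g' y) = (g x < g y)" if x: "x \<in> L1" and y: "y \<in> L2" for x y
  proof -
    have ne: "x \<noteq> n" "y \<noteq> n" "y \<noteq> p" using x y nL p(2) layers(2) L_bounds(2)[OF y] by auto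
    have gy: "g' y = g y" using g'o ne by simp
    show ?thesis
    proof (cases "x = p")
      case True
      have gx: "g' x = 2 * real l' + 1 - e" "g x = 2 * real l' + 1"
        using g'p hL l' True x by auto
      show ?thesis
      proof (cases "y \<in> E")
        case True
        then obtain t :: nat where "g y = 2 * real t" using g_top[OF y] by auto
        then show ?thesis unfolding gy gx using e by (cases "t \<le> l'") auto
      next
        case False
        then obtain k :: nat where k: "g y = 2 * real k + 1 - 1 / (real y + 2)"
          using g_top[OF y] by auto
        have yn: "y < n" using L_bounds(2)[OF y] by simp
        define u where "u = 1 / (real y + 2)"
        have u: "e < u" "u < 1" unfolding e_def u_def using yn by (simp_all add: field_simps)
        consider "real k + 1 \<le> real l'" | "k = l'" | "real l' + 1 \<le> real k" by linarith
        then show ?thesis unfolding gy gx k u_def[symmetric] using e u by cases auto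
      qed
    next
      case False then show ?thesis using g'o ne gy by simp
    qed
  qed
  have m_n: "(g' x < g' n) = (g x < g0)" if x: "x \<in> L1" for x
  proof (cases "x = p")
    case True
    then have "\<not> p < w" "p \<in> L1" using x L_bounds(1)[OF x] by auto
    then show ?thesis using True g'n g'p hL p(2) by simp
  next
    case False
    then show ?thesis using g'n g'L[OF x] by simp
  qed
  have same: "A P' k = A P k" if "k < n" for k
  proof -
    have "\<forall>x\<le>k. \<forall>y\<le>k. P' x y = P x y" unfolding P'_def using that by auto
    then show ?thesis using online unfolding online_def by blast
  qed
  have "position A w m (Suc n) P' L1 (insert n L2) ?E (insert p M) g' i"
  proof
    show "w \<le> Suc n" using w_le by simp
    show "L1 \<union> insert n L2 = {w..<Suc n}"
      using layers(1) w_le atLeastLessThanSuc[of w n] by simp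
    show "L1 \<inter> insert n L2 = {}" using layers(2) nL by auto
    show "P' x y \<longleftrightarrow> x < w \<and> y \<in> L1 \<and> g' x < g' y \<or> x < w \<and> y \<in> insert n L2
        \<or> x \<in> L1 \<and> y \<in> insert n L2 \<and> g' x < g' y" for x y
    proof (cases "y = n")
      case True
      then show ?thesis unfolding P'_def using Pn(1)[of x] m_n[of x] nL(1) by blast
    next
      case False
      then have "P' x y \<longleftrightarrow> P x y" unfolding P'_def by blast
      then show ?thesis using P_iff[of x y] b_m[of x y] m_t[of x y] False by blast
    qed
    show "x < y" if "x \<in> L1" "y \<in> insert n L2" "g' x < g' y" for x y
    proof (cases "y = n")
      case True
      then show ?thesis using that(1) L_bounds(1) by simp
    next
      case False
      then show ?thesis using that order m_t by simp
    qed
    show "?E \<subseteq> insert n L2" using E_sub by (cases st) auto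
    show "insert p M \<subseteq> {..<w} \<union> L1" using M_sub p(2) by blast
    show "card (insert p M) = card (insert n L2)"
      using card_M p(1) nL(2) fin(2,4) by simp
    show "if a \<in> insert p M then \<exists>t::nat. 1 \<le> t \<and> t \<le> i + 1 \<and> g' a = 2 * real t
        else g' a = 2 * real m + 4" if "a < w" for a
    proof (cases "a = p")
      case True
      then show ?thesis using that g'p hw by (auto intro!: exI[of _ "i + 1"])
    next
      case False
      moreover from this have "g' a = g a" using g'w that by auto
      ultimately show ?thesis using g_bottom[OF that] by (cases "a \<in> M") simp_all
    qed
    show "\<exists>l::nat. 1 \<le> l \<and> l \<le> i \<and> (if v \<in> insert p M then 2 * real l < g' v \<and> g' v < 2 * real l + 1
        else g' v = 2 * real l + 1)" if "v \<in> L1" for v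
    proof (cases "v = p")
      case True
      then show ?thesis using that g'p hL l' e by (intro exI[of _ l']) auto
    next
      case False
      moreover from this have "g' v = g v" using g'L that by auto
      ultimately show ?thesis using g_middle[OF that] by (cases "v \<in> M") simp_all
    qed
    show "if b \<in> ?E then \<exists>t::nat. 1 \<le> t \<and> t \<le> i + 1 \<and> g' b = 2 * real t
        else \<exists>l::nat. 1 \<le> l \<and> l \<le> i \<and> g' b = 2 * real l + 1 - 1 / (real b + 2)"
      if "b \<in> insert n L2" for b
    proof (cases "b = n")
      case True
      have "n \<notin> E" using E_sub nL by auto
      then show ?thesis using True g'n st fo by (cases st) (auto intro!: exI[of _ "i + 1"])
    next
      case False
      then have "b \<in> L2" using that by simp
      moreover from this have "g' b = g b"
        using g'o[of b] False p(2) layers(2) L_bounds(2)[of b] by auto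
      ultimately show ?thesis using g_top[of b] False by (cases "b \<in> E") simp_all
    qed
    show "x \<in> insert p M"
      if cp: "chain_partition (Suc n) P' (A P')" and xy: "P' x y" "A P' x = A P' y" for x y
    proof -
      have "P x y \<or> P y x" if "x < n" "y < n" "x \<noteq> y" "A P x = A P y" for x y
      proof -
        have "A P' x = A P' y" using same that by simp
        then have "P' x y \<or> P' y x" using cp that unfolding chain_partition_def by (meson less_SucI)
        then show ?thesis using that unfolding P'_def by blast
      qed
      then have "chain_partition n P (A P)" unfolding chain_partition_def by blast
      note old = colour[OF this]
      show ?thesis
      proof (cases "y = n")
        case False
        then have "P x y" using xy unfolding P'_def by auto
        moreover from this have "A P x = A P y" using P_less[of x y] same xy(2) by simp
        ultimately show ?thesis using old by auto
      next
        case True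
        show ?thesis
        proof (rule ccontr)
          assume no: "x \<notin> insert p M"
          \<comment> \<open>Two unmarked points \<open>x\<close> and \<open>p\<close> with the label
            of \<open>n\<close> would be comparable, and the invariant for the previous position
            says that the lower one is marked.\<close>
          then have gx: "good x" using xy True unfolding good_def by auto
          then have gp: "good p" using good_p by auto
          have "x < w \<or> x \<in> L1" using gx Pn(1) unfolding good_def P'_def by blast
          then have xn: "x < n" using L_bounds(1) w_le by auto
          have col: "A P' x = A P' p" using gx gp unfolding good_def by simp
          then have "P' x p \<or> P' p x"
            using cp no xn pn unfolding chain_partition_def by (metis insertI1 less_SucI)
          then have P: "P x p \<or> P p x" using xn pn unfolding P'_def by blast
          have "A P x = A P p" using col same xn pn by simp
          then show False using P old[of x p] old[of p x] no p(1) by auto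
        qed
      qed
    qed
    show "card {v\<in>L1. g' v < 2 * real t + 2} \<le> card {a. a < w \<and> g' a \<le> 2 * real t}"
      if t: "1 \<le> t" "t \<le> i" for t
    proof -
      have "(g' v < 2 * real t + 2) = (g v < 2 * real t + 2)" if "v \<in> L1" for v
      proof (cases "v = p")
        case True
        then show ?thesis using that g'p hL l' e by (cases "l' \<le> t") auto
      next
        case False
        then show ?thesis using g'L that by auto
      qed
      then have "{v\<in>L1. g' v < 2 * real t + 2} = {v\<in>L1. g v < 2 * real t + 2}" by auto
      moreover have "(g' a \<le> 2 * real t) = (g a \<le> 2 * real t)" if "a < w" for a
      proof (cases "a = p")
        case True
        have "g a = 2 * real m + 4" using g_bottom[OF that] p(1) True by simp
        then show ?thesis using g'p hw True that t im by simp
      next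
        case False
        then show ?thesis using g'w that by auto
      qed
      then have "{a. a < w \<and> g' a \<le> 2 * real t} = {a. a < w \<and> g a \<le> 2 * real t}" by auto
      ultimately show ?thesis using bottom_count[OF t] by simp
    qed
    show "i \<le> card L1" "card L1 \<le> m" by (rule i_le, rule L1_le)
  qed
  moreover have "p < w \<and> h = 2 * (real i + 1) \<or>
      p \<in> L1 \<and> 1 \<le> l' \<and> l' < l \<and> g p = 2 * real l' + 1 \<and> h = 2 * real l' + 1 - 1 / (real n + 2)"
    using p(2) hw hL l' l'l unfolding e_def by auto
  ultimately show ?thesis using that p(1) unfolding g'_def by blast
qed

end


section \<open>The budget that controls the width\<close>

text \<open>
  The key of a top point bounds the antichains through it: \<open>c\<close> plus the number of middle
  points below must be at least the number of top points with at most this key. Non-starters are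
  paid for by marked points (\<open>pend\<close> holds the key of the next one), starters by \<open>c\<close> and the unmarked
  points. Each of the \<open>R\<close> remaining runs may still mark one point in every block, the current run
  only in blocks below \<open>l\<close>.
\<close>

definition budget :: "nat \<Rightarrow> nat set \<Rightarrow> nat set \<Rightarrow> nat set \<Rightarrow> nat set \<Rightarrow> (nat \<Rightarrow> real) \<Rightarrow> nat \<Rightarrow>
    nat \<Rightarrow> real set \<Rightarrow> nat \<Rightarrow> nat \<Rightarrow> bool" where
  "budget c L1 L2 E M g i l pend Q R \<longleftrightarrow>
     (\<forall>C. card {b\<in>L2 - E. g b \<le> C} + card {q\<in>pend. q \<le> C} \<le> card {v\<in>M \<inter> L1. g v < C}) \<and>
     (\<forall>t::nat. 1 \<le> t \<longrightarrow> t \<le> i \<longrightarrow> card {e\<in>E. g e \<le> 2 * real t} + (t - 1) * R + min (t - 1) (l - 1)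
        \<le> c + card {v\<in>L1 - M. g v < 2 * real t}) \<and>
     card E + Q + i * R + (l - 1) \<le> c + card (L1 - M)"

text \<open>A stage is the time between two new blocks. Each of its \<open>r\<close> runs has marked
  one bottom point, with key \<open>2 * (real i + 1)\<close>; earlier stages marked as many bottom
  points as the middle layer has.\<close>

definition stage_marks :: "nat \<Rightarrow> nat set \<Rightarrow> nat set \<Rightarrow> (nat \<Rightarrow> real) \<Rightarrow> nat \<Rightarrow> nat \<Rightarrow> bool" where
  "stage_marks w L1 M g i r \<longleftrightarrow>
     card {a. a < w \<and> a \<in> M \<and> g a = 2 * (real i + 1)} = r \<and> card (M \<inter> {..<w}) = card L1 + r"

context position
begin

lemma exists_unmarked:
  assumes "stage_marks w L1 M g i r" "card L1 + r < w"
  shows "\<exists>a<w. a \<notin> M"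
proof (rule ccontr)
  assume "\<not> ?thesis"
  then have "M \<inter> {..<w} = {..<w}" by auto
  then show False using assms unfolding stage_marks_def by simp
qed

lemma mark_bottom:
  assumes p: "p \<notin> M" "p < w" and sm: "stage_marks w L1 M g i r"
  shows "stage_marks w L1 (insert p M) (g(n := g0, p := 2 * (real i + 1))) i (Suc r)"
proof -
  let ?g = "g(n := g0, p := 2 * (real i + 1))"
  have nw: "\<not> n < w" using w_le by simp
  have "{a. a < w \<and> a \<in> insert p M \<and> ?g a = 2 * (real i + 1)}
      = insert p {a. a < w \<and> a \<in> M \<and> g a = 2 * (real i + 1)}"
    using p nw by auto
  moreover have "insert p M \<inter> {..<w} = insert p (M \<inter> {..<w})" using p by auto
  ultimately show ?thesis using sm p fin unfolding stage_marks_def by simp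
qed

lemma mark_middle:
  assumes p: "p \<in> L1" and sm: "stage_marks w L1 M g i r"
  shows "stage_marks w L1 (insert p M) (g(n := g0, p := h)) i r"
proof -
  let ?g = "g(n := g0, p := h)"
  have nw: "\<not> n < w" "\<not> p < w" using w_le L_bounds(1)[OF p] by auto
  then have "{a. a < w \<and> a \<in> insert p M \<and> ?g a = 2 * (real i + 1)}
      = {a. a < w \<and> a \<in> M \<and> g a = 2 * (real i + 1)}"
    by auto
  moreover have "insert p M \<inter> {..<w} = M \<inter> {..<w}" using nw by auto
  ultimately show ?thesis using sm unfolding stage_marks_def by simp
qed

lemma fresh:
  assumes p: "p \<notin> M" "p < w \<or> p \<in> L1"
  shows "p \<notin> L2" "p \<notin> E" "p \<noteq> n" "n \<noteq> p" "n \<notin> L2" "n \<notin> L1" "n \<notin> E"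
proof -
  show "p \<notin> L2" using p(2) layers(2) L_bounds(2)[of p] by auto
  then show "p \<notin> E" using E_sub by blast
  show "p \<noteq> n" using p(2) L_bounds(1)[of p] w_le by auto
  then show "n \<noteq> p" by simp
  show "n \<notin> L2" "n \<notin> L1" using L_bounds[of n] by auto
  then show "n \<notin> E" using E_sub by blast
qed

lemma card_marked:
  assumes p: "p \<notin> M" "p < w \<or> p \<in> L1"
  shows "card {v\<in>insert p M \<inter> L1. (g(n := g0, p := h)) v < C}
    = card {v\<in>M \<inter> L1. g v < C} + (if p \<in> L1 \<and> h < C then 1 else 0)"
proof -
  note u = fresh[OF p]
  have "{v\<in>insert p M \<inter> L1. (g(n := g0, p := h)) v < C}
      = {v\<in>M \<inter> L1. g v < C} \<union> (if p \<in> L1 \<and> h < C then {p} else {})"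
    using u p(1) by auto
  then show ?thesis using fin p(1) by auto
qed

lemma card_unmarked:
  assumes p: "p \<notin> M" "p < w \<or> p \<in> L1"
  shows "card {v\<in>L1 - insert p M. (g(n := g0, p := h)) v < C} + (if p \<in> L1 \<and> g p < C then 1 else 0)
    = card {v\<in>L1 - M. g v < C}"
proof -
  note u = fresh[OF p]
  let ?X = "{v\<in>L1 - insert p M. (g(n := g0, p := h)) v < C}"
  have "{v\<in>L1 - M. g v < C} = ?X \<union> (if p \<in> L1 \<and> g p < C then {p} else {})"
    using u p(1) by auto
  moreover have "finite ?X" "p \<notin> ?X" using fin by auto
  ultimately show ?thesis by auto
qed

lemma card_unmarked_all:
  assumes p: "p \<notin> M" "p < w \<or> p \<in> L1"
  shows "card (L1 - insert p M) + (if p \<in> L1 then 1 else 0) = card (L1 - M)"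
proof -
  have "card (L1 - M) = card ((L1 - insert p M) \<union> (if p \<in> L1 then {p} else {}))"
    using p(1) by (intro arg_cong[where f = card]) auto
  then show ?thesis using fin by (cases "p \<in> L1") auto
qed

text \<open>The new point takes the pending key, for which a marked point was reserved. A newly
  marked middle point has key \<open>h\<close> below the next pending key and pays for it; its loss
  as an unmarked point is covered by the drop from \<open>l\<close> to \<open>l'\<close>.\<close>

lemma follower_step:
  assumes b: "budget (w - m) L1 L2 E M g i l {g0} Q R" and l: "1 \<le> l" "l \<le> i"
    and g0: "g0 = 2 * real l + 1 - 1 / (real n + 2)"
    and p: "p \<notin> M" and c: "p < w \<and> l' = 1 \<and> pend = {} \<or>
      p \<in> L1 \<and> 1 \<le> l' \<and> l' < l \<and> g p = 2 * real l' + 1 \<and> h = 2 * real l' + 1 - 1 / (real n + 2)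
        \<and> pend = {2 * real l' + 1 - 1 / (real (Suc n) + 2)}"
  shows "budget (w - m) L1 (insert n L2) E (insert p M) (g(n := g0, p := h)) i l' pend Q R"
proof -
  let ?g = "g(n := g0, p := h)"
  have p': "p < w \<or> p \<in> L1" using c by auto
  note u = fresh[OF p p'] and cm = card_marked[OF p p'] and cu = card_unmarked[OF p p']
    and ca = card_unmarked_all[OF p p']
  have pw: "p \<notin> L1" if "p < w" using that L_bounds(1)[of p] by auto
  have b1: "\<And>C. card {b\<in>L2 - E. g b \<le> C} + card {q\<in>{g0}. q \<le> C} \<le> card {v\<in>M \<inter> L1. g v < C}"
    and b2: "\<And>t::nat. 1 \<le> t \<Longrightarrow> t \<le> i \<Longrightarrow> card {e\<in>E. g e \<le> 2 * real t} + (t - 1) * R + min (t - 1) (l - 1)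
        \<le> (w - m) + card {v\<in>L1 - M. g v < 2 * real t}"
    and b3: "card E + Q + i * R + (l - 1) \<le> (w - m) + card (L1 - M)"
    using b unfolding budget_def by auto
  have E: "{e\<in>E. ?g e \<le> C} = {e\<in>E. g e \<le> C}" for C using u by auto
  have T: "card {b\<in>insert n L2 - E. ?g b \<le> C} = card {b\<in>L2 - E. g b \<le> C} + card {q\<in>{g0}. q \<le> C}" for C
  proof -
    have "{b\<in>insert n L2 - E. ?g b \<le> C} = {b\<in>L2 - E. g b \<le> C} \<union> (if g0 \<le> C then {n} else {})"
      using u by auto
    moreover have "{q\<in>{g0}. q \<le> C} = (if g0 \<le> C then {g0} else {})" by auto
    ultimately show ?thesis using fin u by auto
  qed
  have pend: "card {q\<in>pend. q \<le> C} \<le> (if p \<in> L1 \<and> h < C then 1 else 0)" for C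
  proof (cases "p < w")
    case True
    then show ?thesis using c pw by auto
  next
    case False
    then have hp: "h = 2 * real l' + 1 - 1 / (real n + 2)"
      "pend = {2 * real l' + 1 - 1 / (real (Suc n) + 2)}" "p \<in> L1" using c by auto
    have "1 / (real (Suc n) + 2) < 1 / (real n + 2)" by (simp add: field_simps)
    then have "h < 2 * real l' + 1 - 1 / (real (Suc n) + 2)" unfolding hp by simp
    moreover have "{q\<in>{z}. q \<le> C} = (if z \<le> C then {z} else {})" for z by auto
    ultimately show ?thesis using hp(2,3) by auto
  qed
  show ?thesis
    unfolding budget_def E
  proof (intro conjI allI impI)
    fix C
    show "card {b\<in>insert n L2 - E. ?g b \<le> C} + card {q\<in>pend. q \<le> C}
        \<le> card {v\<in>insert p M \<inter> L1. ?g v < C}"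
      unfolding T cm using b1[of C] pend[of C] by linarith
  next
    fix t :: nat assume t: "1 \<le> t" "t \<le> i"
    have "min (t - 1) (l' - 1) + (if p \<in> L1 \<and> g p < 2 * real t then 1 else 0) \<le> min (t - 1) (l - 1)"
    proof (cases "p < w")
      case True then show ?thesis using c pw by auto
    next
      case False
      then have q: "1 \<le> l'" "l' < l" "g p = 2 * real l' + 1" using c by auto
      have "g p < 2 * real t \<Longrightarrow> l' < t" unfolding q(3) by linarith
      then show ?thesis using q by auto
    qed
    then show "card {e\<in>E. g e \<le> 2 * real t} + (t - 1) * R + min (t - 1) (l' - 1)
        \<le> (w - m) + card {v\<in>L1 - insert p M. ?g v < 2 * real t}"
      using b2[OF t] cu[of g0 h "2 * real t"] by linarith
  next
    have "(l' - 1) + (if p \<in> L1 then 1 else 0) \<le> l - 1" using c pw l by auto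
    then show "card E + Q + i * R + (l' - 1) \<le> (w - m) + card (L1 - insert p M)"
      using b3 ca by linarith
  qed
qed

text \<open>The starter consumes one unit of \<open>Q\<close>. Lowering \<open>R\<close> by one
  frees \<open>t - 1\<close> units in the clause for \<open>t\<close> and \<open>i\<close> units in
  the last one; they pay for the point marked now and for those the run may still mark in lower
  blocks.\<close>

lemma starter_step:
  assumes b: "budget (w - m) L1 L2 E M g i 1 {} (Suc Q) (Suc R)"
    and g0: "g0 = 2 * (real i + 1)"
    and p: "p \<notin> M" and c: "p < w \<and> l' = 1 \<and> pend = {} \<or>
      p \<in> L1 \<and> 1 \<le> l' \<and> l' < i + 1 \<and> g p = 2 * real l' + 1 \<and> h = 2 * real l' + 1 - 1 / (real n + 2)
        \<and> pend = {2 * real l' + 1 - 1 / (real (Suc n) + 2)}"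
  shows "budget (w - m) L1 (insert n L2) (insert n E) (insert p M) (g(n := g0, p := h)) i l' pend Q R"
proof -
  let ?g = "g(n := g0, p := h)"
  have p': "p < w \<or> p \<in> L1" using c by auto
  note u = fresh[OF p p'] and cm = card_marked[OF p p'] and cu = card_unmarked[OF p p']
    and ca = card_unmarked_all[OF p p']
  have pw: "p \<notin> L1" if "p < w" using that L_bounds(1)[of p] by auto
  have b1: "\<And>C. card {b\<in>L2 - E. g b \<le> C} \<le> card {v\<in>M \<inter> L1. g v < C}"
    and b2: "\<And>t::nat. 1 \<le> t \<Longrightarrow> t \<le> i \<Longrightarrow> card {e\<in>E. g e \<le> 2 * real t} + (t - 1) * Suc R
        \<le> (w - m) + card {v\<in>L1 - M. g v < 2 * real t}"
    and b3: "card E + Suc Q + i * Suc R \<le> (w - m) + card (L1 - M)"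
    using b unfolding budget_def by auto
  have E: "{e\<in>insert n E. ?g e \<le> 2 * real t} = {e\<in>E. g e \<le> 2 * real t}" if "t \<le> i" for t :: nat
    using u that g0 by auto
  have T: "{b\<in>insert n L2 - insert n E. ?g b \<le> C} = {b\<in>L2 - E. g b \<le> C}" for C
    using u by auto
  have pend: "card {q\<in>pend. q \<le> C} \<le> (if p \<in> L1 \<and> h < C then 1 else 0)" for C
  proof (cases "p < w")
    case True
    then show ?thesis using c pw by auto
  next
    case False
    then have hp: "h = 2 * real l' + 1 - 1 / (real n + 2)"
      "pend = {2 * real l' + 1 - 1 / (real (Suc n) + 2)}" "p \<in> L1" using c by auto
    have "1 / (real (Suc n) + 2) < 1 / (real n + 2)" by (simp add: field_simps)
    then have "h < 2 * real l' + 1 - 1 / (real (Suc n) + 2)" unfolding hp by simp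
    moreover have "{q\<in>{z}. q \<le> C} = (if z \<le> C then {z} else {})" for z by auto
    ultimately show ?thesis using hp(2,3) by auto
  qed
  show ?thesis
    unfolding budget_def
  proof (intro conjI allI impI)
    fix C
    show "card {b\<in>insert n L2 - insert n E. ?g b \<le> C} + card {q\<in>pend. q \<le> C}
        \<le> card {v\<in>insert p M \<inter> L1. ?g v < C}"
      unfolding T cm using b1[of C] pend[of C] by linarith
  next
    fix t :: nat assume t: "1 \<le> t" "t \<le> i"
    have "min (t - 1) (l' - 1) + (if p \<in> L1 \<and> g p < 2 * real t then 1 else 0) \<le> t - 1"
    proof (cases "p < w")
      case True then show ?thesis using c pw by auto
    next
      case False
      then have q: "1 \<le> l'" "g p = 2 * real l' + 1" using c by auto
      have "g p < 2 * real t \<Longrightarrow> l' < t" unfolding q(2) by linarith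
      then show ?thesis using q by auto
    qed
    then show "card {e\<in>insert n E. ?g e \<le> 2 * real t} + (t - 1) * R + min (t - 1) (l' - 1)
        \<le> (w - m) + card {v\<in>L1 - insert p M. ?g v < 2 * real t}"
      using b2[OF t] cu[of g0 h "2 * real t"] unfolding E[OF t(2)] by simp
  next
    have "(l' - 1) + (if p \<in> L1 then 1 else 0) \<le> i" using c pw by auto
    then show "card (insert n E) + Q + i * R + (l' - 1) \<le> (w - m) + card (L1 - insert p M)"
      using b3 ca u fin by simp
  qed
qed

end

context spoiler
begin

text \<open>The block index drops strictly with every follower, so the run ends, and it ends by
  marking exactly one bottom point.\<close>

lemma follower_run:
  assumes "position A w m n P L1 L2 E M g i" "stage_marks w L1 M g i r" "card L1 + r < w"
    and "1 \<le> l" "l \<le> i"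
    and "budget (w - m) L1 L2 E M g i l {2 * real l + 1 - 1 / (real n + 2)} Q R"
  shows "\<exists>n P L2 E M g. position A w m n P L1 L2 E M g i \<and> stage_marks w L1 M g i (Suc r) \<and>
    budget (w - m) L1 L2 E M g i 1 {} Q R"
  using assms
proof (induction l arbitrary: n P L2 M g rule: less_induct)
  case (less l)
  interpret position A w m n P L1 L2 E M g i by (rule less.prems(1))
  define g0 where "g0 = 2 * real l + 1 - 1 / (real n + 2)"
  have b: "budget (w - m) L1 L2 E M g i l {g0} Q R" using less.prems(6) unfolding g0_def .
  obtain P' p l' h where p: "p \<notin> M"
    and pos: "position A w m (Suc n) P' L1 (insert n L2) E (insert p M) (g(n := g0, p := h)) i"
    and c: "p < w \<and> h = 2 * (real i + 1) \<or>
      p \<in> L1 \<and> 1 \<le> l' \<and> l' < l \<and> g p = 2 * real l' + 1 \<and> h = 2 * real l' + 1 - 1 / (real n + 2)"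
    by (rule add_top[OF exists_unmarked[OF less.prems(2,3)], of False l g0])
      (use less.prems(4,5) g0_def in simp_all)
  show ?case
  proof (cases "p < w")
    case True
    then have "p \<notin> L1" using L_bounds(1)[of p] by auto
    then have h: "h = 2 * (real i + 1)" using c by auto
    have "budget (w - m) L1 (insert n L2) E (insert p M) (g(n := g0, p := h)) i 1 {} Q R"
      by (rule follower_step[OF b less.prems(4,5) g0_def p]) (use True in simp)
    moreover have "stage_marks w L1 (insert p M) (g(n := g0, p := h)) i (Suc r)"
      unfolding h by (rule mark_bottom[OF p True less.prems(2)])
    ultimately show ?thesis using pos by blast
  next
    case False
    then have c': "p \<in> L1" "1 \<le> l'" "l' < l" "g p = 2 * real l' + 1" "h = 2 * real l' + 1 - 1 / (real n + 2)"
      using c by auto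
    have bud: "budget (w - m) L1 (insert n L2) E (insert p M) (g(n := g0, p := h)) i l'
        {2 * real l' + 1 - 1 / (real (Suc n) + 2)} Q R"
      by (rule follower_step[OF b less.prems(4,5) g0_def p]) (use c' in simp)
    show ?thesis
      by (rule less.IH[OF c'(3) pos mark_middle[OF c'(1) less.prems(2)] less.prems(3) c'(2) _ bud])
        (use c'(3) less.prems(5) in simp)
  qed
qed

lemma starter_run:
  assumes "position A w m n P L1 L2 E M g i" "stage_marks w L1 M g i r" "card L1 + r < w"
    and "budget (w - m) L1 L2 E M g i 1 {} (Suc Q) (Suc R)"
  shows "\<exists>n P L2 E M g. position A w m n P L1 L2 E M g i \<and> stage_marks w L1 M g i (Suc r) \<and>
    budget (w - m) L1 L2 E M g i 1 {} Q R"
proof -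
  interpret position A w m n P L1 L2 E M g i by (rule assms(1))
  define g0 where "g0 = 2 * (real i + 1)"
  obtain P' p l' h where p: "p \<notin> M"
    and pos: "position A w m (Suc n) P' L1 (insert n L2) (insert n E) (insert p M) (g(n := g0, p := h)) i"
    and c: "p < w \<and> h = 2 * (real i + 1) \<or>
      p \<in> L1 \<and> 1 \<le> l' \<and> l' < i + 1 \<and> g p = 2 * real l' + 1 \<and> h = 2 * real l' + 1 - 1 / (real n + 2)"
    by (rule add_top[OF exists_unmarked[OF assms(2,3)], of True "i + 1" g0])
      (use g0_def in simp_all)
  show ?thesis
  proof (cases "p < w")
    case True
    then have "p \<notin> L1" using L_bounds(1)[of p] by auto
    then have h: "h = 2 * (real i + 1)" using c by auto
    have "budget (w - m) L1 (insert n L2) (insert n E) (insert p M) (g(n := g0, p := h)) i 1 {} Q R"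
      by (rule starter_step[OF assms(4) g0_def p]) (use True in simp)
    moreover have "stage_marks w L1 (insert p M) (g(n := g0, p := h)) i (Suc r)"
      unfolding h by (rule mark_bottom[OF p True assms(2)])
    ultimately show ?thesis using pos by blast
  next
    case False
    then have c': "p \<in> L1" "1 \<le> l'" "l' < i + 1" "g p = 2 * real l' + 1" "h = 2 * real l' + 1 - 1 / (real n + 2)"
      using c by auto
    have bud: "budget (w - m) L1 (insert n L2) (insert n E) (insert p M) (g(n := g0, p := h)) i l'
        {2 * real l' + 1 - 1 / (real (Suc n) + 2)} Q R"
      by (rule starter_step[OF assms(4) g0_def p]) (use c' in simp)
    show ?thesis
      by (rule follower_run[OF pos mark_middle[OF c'(1) assms(2)] assms(3) c'(2) _ bud])
        (use c'(3) in simp)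
  qed
qed

lemma starter_runs:
  assumes "position A w m n P L1 L2 E M g i" "stage_marks w L1 M g i r" "card L1 + r + s \<le> w"
    and "budget (w - m) L1 L2 E M g i 1 {} (Q + s) (R + s)"
  shows "\<exists>n P L2 E M g. position A w m n P L1 L2 E M g i \<and> stage_marks w L1 M g i (r + s) \<and>
    budget (w - m) L1 L2 E M g i 1 {} Q R"
  using assms
proof (induction s arbitrary: n P L2 E M g r)
  case 0
  then show ?case by (simp only: add_0_right) blast
next
  case (Suc s)
  obtain n' P' L2' E' M' g' where pos: "position A w m n' P' L1 L2' E' M' g' i"
    and sm: "stage_marks w L1 M' g' i (Suc r)"
    and bud: "budget (w - m) L1 L2' E' M' g' i 1 {} (Q + s) (R + s)"
    using starter_run[OF Suc.prems(1,2), of "Q + s" "R + s"] Suc.prems(3,4) by auto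
  show ?case using Suc.IH[OF pos sm _ bud] Suc.prems(3) by simp
qed

text \<open>The new block is placed above exactly the marked bottom points, so no chain can enter it
  from an unmarked point. Its \<open>r\<close> unmarked points enlarge the budget, while each of the
  \<open>R\<close> remaining runs may later mark a point in one block more; hence
  \<open>Q + r - R\<close>.\<close>

lemma add_block:
  assumes "position A w m n P L1 L2 E M g i" "stage_marks w L1 M g i r" "1 \<le> r"
    and tot: "card L1 + r + R = m" and bud: "budget (w - m) L1 L2 E M g i 1 {} Q R"
    and le: "R \<le> Q + r"
  shows "\<exists>n P L1 L2 E M g i. position A w m n P L1 L2 E M g i \<and> stage_marks w L1 M g i 0 \<and>
    card L1 + R = m \<and> budget (w - m) L1 L2 E M g i 1 {} (Q + r - R) R"
proof -
  interpret position A w m n P L1 L2 E M g i by (rule assms(1))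
  define N where "N = {n..<n + r}"
  have N_def': "x \<in> N \<longleftrightarrow> n \<le> x \<and> x < n + r" for x unfolding N_def by auto
  have finN: "finite N" "card N = r" unfolding N_def by auto
  define g' where "g' x = (if x \<in> N then 2 * (real i + 1) + 1 else g x)" for x
  define P' where "P' x y \<longleftrightarrow> P x y \<or> x < w \<and> y \<in> N \<and> g x < 2 * (real i + 1) + 1" for x y
  have N: "x \<notin> N" if "x < n" for x using that N_def' by simp
  have L: "x \<notin> N" if "x \<in> L1 \<union> L2" for x
    using that L_bounds(1)[of x] L_bounds(2)[of x] N[of x] by auto
  have W: "x \<notin> N" if "x < w" for x using that w_le N[of x] by auto
  have M: "x \<notin> N" if "x \<in> M" for x using that M_sub L[of x] W[of x] by auto
  have go: "g' x = g x" if "x \<notin> N" for x using that unfolding g'_def by simp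
  have gn: "g' x = 2 * (real i + 1) + 1" if "x \<in> N" for x using that unfolding g'_def by simp
  have gL: "g' x = g x" if "x \<in> L1 \<union> L2" for x using go L that by blast
  have gE: "g' x = g x" if "x \<in> E" for x using gL E_sub that by blast
  have gW: "g' x = g x" if "x < w" for x using go W that by blast
  have cL: "card (L1 \<union> N) = card L1 + r"
    using L fin finN by (subst card_Un_disjoint) auto
  have i1: "i + 1 \<le> m" using i_le tot assms(3) by simp
  have low: "g a \<le> 2 * (real i + 1) \<longleftrightarrow> a \<in> M" if aw: "a < w" for a
  proof (cases "a \<in> M")
    case True
    then obtain t :: nat where "t \<le> i + 1" "g a = 2 * real t" using g_bottom[OF aw] by auto
    then show ?thesis using True by simp
  next
    case False
    then have "g a = 2 * real m + 4" using g_bottom[OF aw] by simp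
    then show ?thesis using False i1 by simp
  qed
  have L1_range: "g v \<le> 2 * real i + 1" if "v \<in> L1" for v
    using g_middle[OF that] by (auto split: if_splits)
  have L2_range: "g b \<le> 2 * (real i + 1)" if bL: "b \<in> L2" for b
  proof (cases "b \<in> E")
    case True
    then show ?thesis using g_top[OF bL] by auto
  next
    case False
    then obtain l :: nat where l: "l \<le> i" "g b = 2 * real l + 1 - 1 / (real b + 2)"
      using g_top[OF bL] by auto
    define u where "u = 1 / (real b + 2)"
    have "0 < u" unfolding u_def by simp
    then show ?thesis using l unfolding u_def[symmetric] by simp
  qed
  have same: "A P' k = A P k" if "k < n" for k
  proof -
    have "\<forall>x\<le>k. \<forall>y\<le>k. P' x y = P x y"
      unfolding P'_def using that N by (meson le_less_trans)
    then show ?thesis using online unfolding online_def by blast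
  qed
  have pos: "position A w m (n + r) P' (L1 \<union> N) L2 E M g' (i + 1)"
  proof
    show "w \<le> n + r" using w_le by simp
    show "L1 \<union> N \<union> L2 = {w..<n + r}"
    proof -
      have "{w..<n + r} = {w..<n} \<union> N" unfolding N_def using w_le by auto
      then show ?thesis using layers(1) by blast
    qed
    show "(L1 \<union> N) \<inter> L2 = {}" using layers(2) L by blast
    show "P' x y \<longleftrightarrow> x < w \<and> y \<in> L1 \<union> N \<and> g' x < g' y \<or> x < w \<and> y \<in> L2
        \<or> x \<in> L1 \<union> N \<and> y \<in> L2 \<and> g' x < g' y" for x y
    proof (cases "y \<in> N")
      case True
      then have "\<not> P x y" using P_less[of x y] N[of y] by auto
      moreover have "y \<notin> L1" "y \<notin> L2" using True L by blast+
      ultimately show ?thesis using True gn[OF True] gW[of x] unfolding P'_def by auto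
    next
      case False
      have "\<not> g' x < g' y" if "x \<in> N" "y \<in> L2"
        using gn[OF that(1)] gL[of y] that(2) L2_range[of y] by simp
      then show ?thesis
        using False P_iff[of x y] gL[of x] gL[of y] gW[of x] unfolding P'_def by auto
    qed
    show "x < y" if "x \<in> L1 \<union> N" "y \<in> L2" "g' x < g' y" for x y
    proof (cases "x \<in> N")
      case True
      then show ?thesis using that gn[OF True] gL[of y] L2_range[of y] by simp
    next
      case False
      then show ?thesis using that order[of x y] gL[of x] gL[of y] by auto
    qed
    show "E \<subseteq> L2" by (rule E_sub)
    show "M \<subseteq> {..<w} \<union> (L1 \<union> N)" using M_sub by blast
    show "card M = card L2" by (rule card_M)
    show "if a \<in> M then \<exists>t::nat. 1 \<le> t \<and> t \<le> i + 1 + 1 \<and> g' a = 2 * real t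
        else g' a = 2 * real m + 4" if "a < w" for a
      using g_bottom[OF that] gW[OF that] by (cases "a \<in> M") force+
    show "\<exists>l::nat. 1 \<le> l \<and> l \<le> i + 1 \<and> (if v \<in> M then 2 * real l < g' v \<and> g' v < 2 * real l + 1
        else g' v = 2 * real l + 1)" if v: "v \<in> L1 \<union> N" for v
    proof (cases "v \<in> N")
      case True
      then show ?thesis using gn[OF True] M by (intro exI[of _ "i + 1"]) auto
    next
      case False
      then have "v \<in> L1" using v by simp
      then show ?thesis using g_middle[of v] gL[of v] by (cases "v \<in> M") force+
    qed
    show "if b \<in> E then \<exists>t::nat. 1 \<le> t \<and> t \<le> i + 1 + 1 \<and> g' b = 2 * real t
        else \<exists>l::nat. 1 \<le> l \<and> l \<le> i + 1 \<and> g' b = 2 * real l + 1 - 1 / (real b + 2)"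
      if "b \<in> L2" for b
      using g_top[OF that] gL[of b] that by (cases "b \<in> E") force+
    show "x \<in> M"
      if cp: "chain_partition (n + r) P' (A P')" and xy: "P' x y" "A P' x = A P' y" for x y
    proof (cases "y \<in> N")
      case True
      then have "\<not> P x y" using P_less[of x y] N[of y] by auto
      then have x: "x < w" "g x < 2 * (real i + 1) + 1" using xy(1) unfolding P'_def by auto
      show ?thesis using g_bottom[OF x(1)] x(2) i1 by (cases "x \<in> M") auto
    next
      case False
      have "P x y \<or> P y x" if "x < n" "y < n" "x \<noteq> y" "A P x = A P y" for x y
      proof -
        have "A P' x = A P' y" using same that by simp
        have "x < n + r" "y < n + r" using that by auto
        then have "P' x y \<or> P' y x"
          using cp that(3) \<open>A P' x = A P' y\<close> unfolding chain_partition_def by blast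
        then show ?thesis using that N unfolding P'_def by blast
      qed
      then have "chain_partition n P (A P)" unfolding chain_partition_def by blast
      note old = colour[OF this]
      have "P x y" using xy(1) False unfolding P'_def by blast
      moreover from this have "A P x = A P y" using P_less[of x y] same xy(2) by simp
      ultimately show ?thesis using old by blast
    qed
    show "card {v\<in>L1 \<union> N. g' v < 2 * real t + 2} \<le> card {a. a < w \<and> g' a \<le> 2 * real t}"
      if t: "1 \<le> t" "t \<le> i + 1" for t
    proof -
      have A: "{a. a < w \<and> g' a \<le> 2 * real t} = {a. a < w \<and> g a \<le> 2 * real t}" using gW by auto
      show ?thesis
      proof (cases "t \<le> i")
        case True
        have "{v\<in>L1 \<union> N. g' v < 2 * real t + 2} = {v\<in>L1. g v < 2 * real t + 2}"
          using gL gn True by auto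
        then show ?thesis using bottom_count[OF t(1) True] unfolding A by simp
      next
        case False
        then have t': "real t = real i + 1" using t by auto
        have "card {v\<in>L1 \<union> N. g' v < 2 * real t + 2} \<le> card (L1 \<union> N)"
          using fin finN by (intro card_mono) auto
        also have "\<dots> = card (M \<inter> {..<w})" using cL assms(2) unfolding stage_marks_def by simp
        also have "M \<inter> {..<w} = {a. a < w \<and> g a \<le> 2 * real t}" unfolding t' using low by auto
        finally show ?thesis unfolding A .
      qed
    qed
    show "i + 1 \<le> card (L1 \<union> N)" using cL i_le assms(3) by simp
    show "card (L1 \<union> N) \<le> m" using cL tot by simp
  qed
  have sm: "stage_marks w (L1 \<union> N) M g' (i + 1) 0"
  proof -
    have "{a. a < w \<and> a \<in> M \<and> g' a = 2 * (real (i + 1) + 1)} = {}"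
    proof -
      have "g' a \<noteq> 2 * (real (i + 1) + 1)" if "a < w" "a \<in> M" for a
        using low[OF that(1)] that gW[OF that(1)] by simp
      then show ?thesis by blast
    qed
    then have "card {a. a < w \<and> a \<in> M \<and> g' a = 2 * (real (i + 1) + 1)} = 0" by (simp only: card.empty)
    then show ?thesis using assms(2) cL unfolding stage_marks_def by simp
  qed
  have b1: "\<And>C. card {b\<in>L2 - E. g b \<le> C} \<le> card {v\<in>M \<inter> L1. g v < C}"
    and b2: "\<And>t::nat. 1 \<le> t \<Longrightarrow> t \<le> i \<Longrightarrow> card {e\<in>E. g e \<le> 2 * real t} + (t - 1) * R
        \<le> (w - m) + card {v\<in>L1 - M. g v < 2 * real t}"
    and b3: "card E + Q + i * R \<le> (w - m) + card (L1 - M)"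
    using bud unfolding budget_def by auto
  have E': "{e\<in>E. g' e \<le> C} = {e\<in>E. g e \<le> C}" for C using gE by auto
  have T': "{b\<in>L2 - E. g' b \<le> C} = {b\<in>L2 - E. g b \<le> C}" for C using gL by auto
  have M': "{v\<in>M \<inter> (L1 \<union> N). g' v < C} = {v\<in>M \<inter> L1. g v < C}" for C using gL M by auto
  have U': "{v\<in>L1 \<union> N - M. g' v < 2 * real t} = {v\<in>L1 - M. g v < 2 * real t}" if "t \<le> i + 1" for t :: nat
    using gL gn that by auto
  have "L1 \<union> N - M = (L1 - M) \<union> N" using M by blast
  then have UN: "card (L1 \<union> N - M) = card (L1 - M) + r"
    using L fin finN by (subst \<open>L1 \<union> N - M = (L1 - M) \<union> N\<close>, subst card_Un_disjoint) auto
  have bud': "budget (w - m) (L1 \<union> N) L2 E M g' (i + 1) 1 {} (Q + r - R) R"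
    unfolding budget_def E' T' M'
  proof (intro conjI allI impI)
    show "card {b\<in>L2 - E. g b \<le> C} + card {q\<in>{}. q \<le> C} \<le> card {v\<in>M \<inter> L1. g v < C}" for C
      using b1[of C] by simp
    show "card {e\<in>E. g e \<le> 2 * real t} + (t - 1) * R + min (t - 1) (1 - 1)
        \<le> (w - m) + card {v\<in>L1 \<union> N - M. g' v < 2 * real t}" if t: "1 \<le> t" "t \<le> i + 1" for t :: nat
    proof (cases "t \<le> i")
      case True
      then show ?thesis using b2[OF t(1) True] unfolding U'[OF t(2)] by simp
    next
      case False
      then have t': "t = i + 1" using t by simp
      have "{v\<in>L1 - M. g v < 2 * real t} = L1 - M" using L1_range t' by fastforce
      then have eq: "{v\<in>L1 \<union> N - M. g' v < 2 * real t} = L1 - M" using U'[OF t(2)] by simp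
      have "card {e\<in>E. g e \<le> 2 * real t} \<le> card E" using fin by (intro card_mono) auto
      moreover have "(t - 1) * R + min (t - 1) (1 - 1) = i * R" using t' by simp
      ultimately show ?thesis using b3 unfolding eq by linarith
    qed
    show "card E + (Q + r - R) + (i + 1) * R + (1 - 1) \<le> (w - m) + card (L1 \<union> N - M)"
      using b3 le unfolding UN by simp
  qed
  have "card (L1 \<union> N) + R = m" using cL tot by simp
  then show ?thesis using pos sm bud' by blast
qed

end


section \<open>The final position: number of chains, representation and width\<close>

context position
begin

lemma layer_cases: "x < n \<Longrightarrow> x < w \<or> x \<in> L1 \<or> x \<in> L2"
  using layers(1) by (metis UnE atLeastLessThan_iff not_le)

text \<open>By \<open>colour\<close>, an unmarked point is the top of its chain, so unmarked points
  lie on distinct chains. As \<open>card M = card L2\<close>, there are as many of them as bottom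
  and middle points.\<close>

lemma chains_ge:
  assumes "chain_partition n P (A P)"
  shows "w + card L1 \<le> chains_used n (A P)"
proof -
  have Mn: "M \<subseteq> {..<n}" using M_sub L_bounds(1) w_le by fastforce
  have "inj_on (A P) ({..<n} - M)"
  proof (rule inj_onI, rule ccontr)
    fix x y assume xy: "x \<in> {..<n} - M" "y \<in> {..<n} - M" "A P x = A P y" "x \<noteq> y"
    then have "P x y \<or> P y x" using assms unfolding chain_partition_def by auto
    then show False using colour[OF assms, of x y] colour[OF assms, of y x] xy by auto
  qed
  then have "card ({..<n} - M) = card (A P ` ({..<n} - M))" by (rule card_image[symmetric])
  also have "\<dots> \<le> chains_used n (A P)"
    unfolding chains_used_def by (intro card_mono) auto
  finally have "n - card M \<le> chains_used n (A P)"
    using card_Diff_subset[OF fin(4) Mn] by simp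
  moreover have "card L1 + card L2 + w = n"
    using card_Un_disjoint[OF fin(1,2) layers(2)] layers(1) w_le by simp
  ultimately show ?thesis using card_M by simp
qed

lemma g_bounds: "x < n \<Longrightarrow> 0 \<le> g x \<and> g x \<le> 2 * real m + 4"
proof -
  assume x: "x < n"
  have im: "i \<le> m" using i_le L1_le by simp
  have top: "g x \<le> 2 * real m + 4 \<and> 0 \<le> g x" if "x \<in> L2"
  proof (cases "x \<in> E")
    case True
    then show ?thesis using g_top[OF that] im by auto
  next
    case False
    obtain l :: nat where l: "l \<le> i" "g x = 2 * real l + 1 - 1 / (real x + 2)"
      using g_top[OF \<open>x \<in> L2\<close>] False by auto
    define u where "u = 1 / (real x + 2)"
    have "0 < u" "u < 1" unfolding u_def by (auto simp: field_simps)
    then show ?thesis using l im unfolding u_def[symmetric] by simp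
  qed
  have mid: "g x \<le> 2 * real m + 4 \<and> 0 \<le> g x" if "x \<in> L1"
    using g_middle[OF that] im by (cases "x \<in> M") auto
  have bot: "g x \<le> 2 * real m + 4 \<and> 0 \<le> g x" if "x < w"
    using g_bottom[OF that] im by (cases "x \<in> M") auto
  show ?thesis using layer_cases[OF x] top mid bot by blast
qed

lemma semiorder_P: "semiorder n P"
proof -
  \<comment> \<open>Layer number plus a fraction: dividing by \<open>2 * real m + 5\<close> brings
    every key into [0, 1). So adjacent layers compare by keys, and the bottom layer lies below the
    whole top layer.\<close>
  define h where "h x = (if x < w then 0 else if x \<in> L1 then 1 else 2) + g x / (2 * real m + 5)" for x
  have "P x y \<longleftrightarrow> h x + 1 < h y" if xy: "x < n" "y < n" for x y
  proof -
    define u v where "u = g x / (2 * real m + 5)" and "v = g y / (2 * real m + 5)"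
    have uv: "0 \<le> u" "u < 1" "0 \<le> v" "v < 1"
      using g_bounds[OF xy(1)] g_bounds[OF xy(2)] unfolding u_def v_def by (auto simp: field_simps)
    have lt: "u < v \<longleftrightarrow> g x < g y" unfolding u_def v_def by (simp add: divide_less_cancel)
    have k: "x < w \<and> x \<notin> L1 \<and> x \<notin> L2 \<or> \<not> x < w \<and> x \<in> L1 \<and> x \<notin> L2 \<or> \<not> x < w \<and> x \<notin> L1 \<and> x \<in> L2"
      if "x < n" for x
      using layer_cases[OF that] layers(2) L_bounds(1)[of x] L_bounds(2)[of x] by auto
    show ?thesis
      unfolding P_iff h_def u_def[symmetric] v_def[symmetric] lt[symmetric]
      using k[OF xy(1)] k[OF xy(2)] uv by (elim disjE conjE) simp_all
  qed
  then show ?thesis unfolding semiorder_def by blast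
qed

lemma up_growing_P: "up_growing n P"
  unfolding up_growing_def using P_less by (meson less_asym)

text \<open>Non-starters are bounded by the first clause of the budget. Starter keys are even
  integers, so below a follower of block \<open>l\<close> only those up to 2 l matter, and the
  clause for \<open>t = l\<close> applies. A starter \<open>b\<close> uses the clause of its own
  key, or the last clause if that key is 2 (i + 1).\<close>

lemma top_window:
  assumes bud: "budget (w - m) L1 L2 E M g i l pend Q R" and b: "b \<in> L2"
  shows "card {b'\<in>L2. g b' \<le> g b} \<le> (w - m) + card {v\<in>L1. g v < g b}"
proof -
  define C where "C = g b"
  have b1: "card {b\<in>L2 - E. g b \<le> C} \<le> card {v\<in>M \<inter> L1. g v < C}"
    and b2: "\<And>t::nat. 1 \<le> t \<Longrightarrow> t \<le> i \<Longrightarrow> card {e\<in>E. g e \<le> 2 * real t}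
        \<le> (w - m) + card {v\<in>L1 - M. g v < 2 * real t}"
    and b3: "card E \<le> (w - m) + card (L1 - M)"
  proof -
    note bud' = bud[unfolded budget_def]
    show "card {b\<in>L2 - E. g b \<le> C} \<le> card {v\<in>M \<inter> L1. g v < C}"
      using bud'[THEN conjunct1, rule_format, of C] by linarith
    show "card {e\<in>E. g e \<le> 2 * real t} \<le> (w - m) + card {v\<in>L1 - M. g v < 2 * real t}"
      if "1 \<le> t" "t \<le> i" for t :: nat
      using bud'[THEN conjunct2, THEN conjunct1, rule_format, OF that] by linarith
    show "card E \<le> (w - m) + card (L1 - M)"
      using bud'[THEN conjunct2, THEN conjunct2] by linarith
  qed
  have L1_range: "g v < 2 * (real i + 1)" if "v \<in> L1" for v
    using g_middle[OF that] by (auto split: if_splits)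
  have b2': "card {e\<in>E. g e \<le> 2 * real t} \<le> (w - m) + card {v\<in>L1 - M. g v < 2 * real t}"
    if t: "1 \<le> t" "t \<le> i + 1" for t :: nat
  proof (cases "t \<le> i")
    case True then show ?thesis using b2 t by blast
  next
    case False
    then have "t = i + 1" using t by simp
    then have "{v\<in>L1 - M. g v < 2 * real t} = L1 - M" using L1_range by fastforce
    moreover have "card {e\<in>E. g e \<le> 2 * real t} \<le> card E" using fin by (intro card_mono) auto
    ultimately show ?thesis using b3 by simp
  qed
  have "card {e\<in>E. g e \<le> C} \<le> (w - m) + card {v\<in>L1 - M. g v < C}"
  proof (cases "b \<in> E")
    case True
    then obtain t :: nat where "1 \<le> t" "t \<le> i + 1" "C = 2 * real t"
      using g_top[OF b] unfolding C_def by auto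
    then show ?thesis using b2' by simp
  next
    case False
    then obtain l :: nat where l: "1 \<le> l" "l \<le> i" "C = 2 * real l + 1 - 1 / (real b + 2)"
      using g_top[OF b] unfolding C_def by auto
    define u where "u = 1 / (real b + 2)"
    have u: "0 < u" "u < 1" unfolding u_def by (auto simp: field_simps)
    have C: "C = 2 * real l + 1 - u" using l(3) unfolding u_def .
    have "g e \<le> 2 * real l" if e: "e \<in> E" "g e \<le> C" for e
    proof -
      have "e \<in> L2" using e E_sub by auto
      then obtain t :: nat where t: "g e = 2 * real t" using g_top[of e] e(1) by auto
      have "t \<le> l" using e(2) u unfolding t C by linarith
      then show ?thesis unfolding t by simp
    qed
    then have "card {e\<in>E. g e \<le> C} \<le> card {e\<in>E. g e \<le> 2 * real l}"
      using fin by (intro card_mono) auto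
    also have "\<dots> \<le> (w - m) + card {v\<in>L1 - M. g v < 2 * real l}" using b2 l by blast
    also have "card {v\<in>L1 - M. g v < 2 * real l} \<le> card {v\<in>L1 - M. g v < C}"
      using fin u unfolding C by (intro card_mono) auto
    finally show ?thesis by simp
  qed
  moreover have "card {b'\<in>L2. g b' \<le> C} \<le> card {e\<in>E. g e \<le> C} + card {b\<in>L2 - E. g b \<le> C}"
  proof -
    have "{b'\<in>L2. g b' \<le> C} \<subseteq> {e\<in>E. g e \<le> C} \<union> {b\<in>L2 - E. g b \<le> C}" by auto
    then have "card {b'\<in>L2. g b' \<le> C} \<le> card ({e\<in>E. g e \<le> C} \<union> {b\<in>L2 - E. g b \<le> C})"
      using fin by (intro card_mono) auto
    then show ?thesis using card_Un_le le_trans by blast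
  qed
  moreover have "card {v\<in>L1 - M. g v < C} + card {v\<in>M \<inter> L1. g v < C} = card {v\<in>L1. g v < C}"
  proof -
    have "{v\<in>L1. g v < C} = {v\<in>L1 - M. g v < C} \<union> {v\<in>M \<inter> L1. g v < C}" by auto
    moreover have "card ({v\<in>L1 - M. g v < C} \<union> {v\<in>M \<inter> L1. g v < C})
        = card {v\<in>L1 - M. g v < C} + card {v\<in>M \<inter> L1. g v < C}"
      using fin by (intro card_Un_disjoint) auto
    ultimately show ?thesis by simp
  qed
  ultimately show ?thesis using b1 unfolding C_def by linarith
qed

text \<open>Take the point with the largest key in the highest layer above the bottom that the
  antichain meets. In the top layer \<open>top_window\<close> pays for the top points by middle
  points lost below; in the middle layer \<open>bottom_count\<close> pays by bottom points lost
  below.\<close>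

lemma antichain_le:
  assumes bud: "budget (w - m) L1 L2 E M g i l pend Q R" and full: "card L1 = m"
    and S: "S \<subseteq> {..<n}" "antichain P S"
  shows "card S \<le> w"
proof -
  have finS: "finite S" using S(1) finite_subset by blast
  have inc: "\<not> P x y" if "x \<in> S" "y \<in> S" for x y using S(2) that unfolding antichain_def by auto
  have S_cases: "x < w \<or> x \<in> L1 \<or> x \<in> L2" if "x \<in> S" for x
    using that S(1) layer_cases by blast
  have ex_max: "\<exists>x\<in>X. \<forall>y\<in>X. g y \<le> g x" if "X \<noteq> {}" "X \<subseteq> S" for X
  proof -
    have "finite X" using that finS finite_subset by blast
    then have "Max (g ` X) \<in> g ` X" using that by (intro Max_in) auto
    then obtain x where "x \<in> X" "g x = Max (g ` X)" by auto
    then show ?thesis using \<open>finite X\<close> by (intro bexI[of _ x]) auto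
  qed
  show ?thesis
  proof (cases "S \<inter> L2 = {}")
    case False
    obtain b where b: "b \<in> S" "b \<in> L2" and mx: "\<And>y. y \<in> S \<inter> L2 \<Longrightarrow> g y \<le> g b"
      using ex_max[of "S \<inter> L2"] False by blast
    have "S \<subseteq> {v\<in>L1. \<not> g v < g b} \<union> {b'\<in>L2. g b' \<le> g b}"
    proof
      fix x assume x: "x \<in> S"
      then have "\<not> P x b" using inc b by blast
      then show "x \<in> {v\<in>L1. \<not> g v < g b} \<union> {b'\<in>L2. g b' \<le> g b}"
        using S_cases[OF x] P_iff[of x b] b(2) mx x by blast
    qed
    then have "card S \<le> card ({v\<in>L1. \<not> g v < g b} \<union> {b'\<in>L2. g b' \<le> g b})"
      using fin by (intro card_mono) auto
    also have "\<dots> \<le> card {v\<in>L1. \<not> g v < g b} + card {b'\<in>L2. g b' \<le> g b}" by (rule card_Un_le)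
    also have "card {v\<in>L1. \<not> g v < g b} = m - card {v\<in>L1. g v < g b}"
    proof -
      have "{v\<in>L1. \<not> g v < g b} = L1 - {v\<in>L1. g v < g b}" by auto
      then show ?thesis using full fin by (simp add: card_Diff_subset)
    qed
    finally show ?thesis
      using top_window[OF bud b(2)] m_le full card_mono[OF fin(1), of "{v\<in>L1. g v < g b}"] by auto
  next
    case no_top: True
    show ?thesis
    proof (cases "S \<inter> L1 = {}")
      case True
      then have "S \<subseteq> {..<w}" using S_cases no_top by blast
      then show ?thesis using card_mono[of "{..<w}" S] by simp
    next
      case False
      obtain v where v: "v \<in> S" "v \<in> L1" and mx: "\<And>y. y \<in> S \<inter> L1 \<Longrightarrow> g y \<le> g v"
        using ex_max[of "S \<inter> L1"] False by blast
      obtain t :: nat where "1 \<le> t" "t \<le> i"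
        and "if v \<in> M then 2 * real t < g v \<and> g v < 2 * real t + 1 else g v = 2 * real t + 1"
        using g_middle[OF v(2)] by blast
      then have t: "1 \<le> t" "t \<le> i" "2 * real t < g v" "g v \<le> 2 * real t + 1"
        by (auto split: if_splits)
      have "S \<subseteq> ({..<w} - {a. a < w \<and> g a \<le> 2 * real t}) \<union> {v\<in>L1. g v < 2 * real t + 2}"
      proof
        fix x assume x: "x \<in> S"
        then have "\<not> P x v" using inc v by blast
        then have "\<not> (x < w \<and> g x < g v)" using P_iff[of x v] v(2) by blast
        moreover have "g x < 2 * real t + 2" if "x \<in> L1" using mx[of x] x that t by force
        ultimately show "x \<in> ({..<w} - {a. a < w \<and> g a \<le> 2 * real t}) \<union> {v\<in>L1. g v < 2 * real t + 2}"
          using S_cases[OF x] no_top x t(3) by force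
      qed
      then have "card S \<le> card (({..<w} - {a. a < w \<and> g a \<le> 2 * real t}) \<union> {v\<in>L1. g v < 2 * real t + 2})"
        using fin by (intro card_mono) auto
      also have "\<dots> \<le> card ({..<w} - {a. a < w \<and> g a \<le> 2 * real t}) + card {v\<in>L1. g v < 2 * real t + 2}"
        by (rule card_Un_le)
      also have "card ({..<w} - {a. a < w \<and> g a \<le> 2 * real t}) = w - card {a. a < w \<and> g a \<le> 2 * real t}"
        by (subst card_Diff_subset) auto
      finally have "card S \<le> w - card {a. a < w \<and> g a \<le> 2 * real t} + card {v\<in>L1. g v < 2 * real t + 2}" .
      moreover have "card {a. a < w \<and> g a \<le> 2 * real t} \<le> w"
        using card_mono[of "{..<w}" "{a. a < w \<and> g a \<le> 2 * real t}"] by auto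
      ultimately show ?thesis using bottom_count[OF t(1,2)] by linarith
    qed
  qed
qed

lemma width_P:
  assumes "budget (w - m) L1 L2 E M g i l pend Q R" "card L1 = m"
  shows "width n P = w"
proof (rule antisym)
  have "\<not> P x y" if "y < w" for x y
    using P_iff[of x y] L_bounds(1)[of y] L_bounds(2)[of y] that by auto
  then have "antichain P {..<w}" unfolding antichain_def by blast
  then show "w \<le> width n P" using card_le_width[of "{..<w}" n P] w_le by simp
  have "\<exists>S. S \<subseteq> {..<n} \<and> antichain P S" by (rule exI[of _ "{}"]) (simp add: antichain_def)
  then show "width n P \<le> w"
    unfolding width_def
    using antichain_le[OF assms] by (subst Max_le_iff[OF finite_antichain_cards]) auto
qed

end

section \<open>The whole game and its value\<close>

context spoiler
begin

text \<open>A stage consists of \<open>min R Q\<close> runs and a new block. If R > Q, then R \<le>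
  gr Q multiplied by gr + 1 yields R - Q \<le> gr (2 Q - R), so the hypothesis survives; otherwise
  no run is left. The hypothesis also keeps Q positive while R is, so R decreases.\<close>

lemma play:
  assumes "position A w m n P L1 L2 E M g i" "stage_marks w L1 M g i 0" "card L1 + R = m"
    and "budget (w - m) L1 L2 E M g i 1 {} Q R" and "real R \<le> gr * Q"
  shows "\<exists>n P L1 L2 E M g i Q. position A w m n P L1 L2 E M g i \<and> card L1 = m \<and>
    budget (w - m) L1 L2 E M g i 1 {} Q 0"
  using assms
proof (induction R arbitrary: n P L1 L2 E M g i Q rule: less_induct)
  case (less R)
  show ?case
  proof (cases "R = 0")
    case True
    have "card L1 = m" using less.prems(3) True by simp
    moreover have "budget (w - m) L1 L2 E M g i 1 {} Q 0" using less.prems(4) unfolding True .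
    ultimately show ?thesis using less.prems(1) by blast
  next
    case False
    have Q: "0 < Q" using less.prems(5) False gr_bounds by (cases Q) auto
    have "gr * real Q \<le> 2 * real Q" using gr_bounds by (intro mult_right_mono) auto
    then have R2: "R \<le> 2 * Q" using less.prems(5) by linarith
    define s where "s = min R Q"
    have s: "1 \<le> s" "s \<le> R" "s \<le> Q" unfolding s_def using Q False by auto
    obtain n1 P1 L21 E1 M1 g1 where pos: "position A w m n1 P1 L1 L21 E1 M1 g1 i"
      and sm: "stage_marks w L1 M1 g1 i (0 + s)" and bud: "budget (w - m) L1 L21 E1 M1 g1 i 1 {} (Q - s) (R - s)"
      using starter_runs[OF less.prems(1,2), of s "Q - s" "R - s"] less.prems(3,4) s m_le by auto
    have tot: "card L1 + (0 + s) + (R - s) = m" using less.prems(3) s by simp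
    have le: "R - s \<le> Q - s + (0 + s)" using R2 s unfolding s_def by auto
    obtain n2 P2 L12 L22 E2 M2 g2 i2 where pos2: "position A w m n2 P2 L12 L22 E2 M2 g2 i2"
      and sm2: "stage_marks w L12 M2 g2 i2 0" and c2: "card L12 + (R - s) = m"
      and bud2: "budget (w - m) L12 L22 E2 M2 g2 i2 1 {} (Q - s + (0 + s) - (R - s)) (R - s)"
      using add_block[OF pos sm _ tot bud le] s by auto
    have "real (R - s) \<le> gr * real (Q - s + (0 + s) - (R - s))"
    proof (cases "R \<le> Q")
      case True
      then have "R - s = 0" unfolding s_def by simp
      then show ?thesis using gr_bounds by simp
    next
      case False
      then have s': "s = Q" unfolding s_def by simp
      have q: "real (Q - s + (0 + s) - (R - s)) = 2 * real Q - real R" "real (R - s) = real R - real Q"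
        using False R2 unfolding s' by auto
      have "(gr + 1) * real R \<le> (gr + 1) * (gr * Q)"
        using less.prems(5) gr_bounds by (intro mult_left_mono) auto
      also have "\<dots> = (gr * gr + gr) * Q" by (simp add: algebra_simps)
      finally show ?thesis unfolding q by (simp add: gr_sq algebra_simps)
    qed
    moreover have "R - s < R" using s(1,2) by simp
    ultimately show ?thesis using less.IH[OF _ pos2 sm2 c2 bud2] by blast
  qed
qed

lemma initial_position: "position A w m w (\<lambda>_ _. False) {} {} {} {} (\<lambda>_. 2 * real m + 4) 0"
  by unfold_locales auto

theorem spoiler_wins:
  assumes valid: "\<And>n P. valid_input w n P \<Longrightarrow> chain_partition n P (A P)"
    and m: "gr * real m \<le> real w"
  shows "\<exists>n P. semiorder n P \<and> up_growing n P \<and> width n P = w \<and> w + m \<le> chains_used n (A P)"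
proof -
  \<comment> \<open>The game starts with \<open>m\<close> runs and budget \<open>w - m\<close>. As
    gr + 1 is the square of gr, the ratio needed there follows from gr m \<le> w.\<close>
  have "(gr + 1) * real m = gr * (gr * real m)" using gr_sq by (metis mult.assoc)
  also have "\<dots> \<le> gr * real w" using m gr_bounds by (intro mult_left_mono) auto
  finally have ratio: "real m \<le> gr * real (w - m)" using m_le by (simp add: of_nat_diff algebra_simps)
  have sm: "stage_marks w {} {} (\<lambda>_. 2 * real m + 4) 0 0" unfolding stage_marks_def by simp
  have bud: "budget (w - m) {} {} {} {} (\<lambda>_. 2 * real m + 4) 0 1 {} (w - m) m"
    unfolding budget_def by simp
  obtain n P L1 L2 E M g i Q where pos: "position A w m n P L1 L2 E M g i" and full: "card L1 = m"
    and final: "budget (w - m) L1 L2 E M g i 1 {} Q 0"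
    using play[OF initial_position sm _ bud ratio] by auto
  interpret position A w m n P L1 L2 E M g i by (rule pos)
  have P: "semiorder n P" "up_growing n P" "width n P = w"
    using semiorder_P up_growing_P width_P[OF final full] by auto
  then have "chain_partition n P (A P)" using valid unfolding valid_input_def by simp
  then show ?thesis using P chains_ge full by auto
qed

end

lemma floor_gr: "\<lfloor>gr * real w\<rfloor> = int (w + nat \<lfloor>(gr - 1) * real w\<rfloor>)"
proof -
  have "gr * real w = (gr - 1) * real w + real_of_int (int w)" by (simp add: algebra_simps)
  then have "\<lfloor>gr * real w\<rfloor> = \<lfloor>(gr - 1) * real w\<rfloor> + int w" by (metis floor_add_int)
  moreover have "0 \<le> \<lfloor>(gr - 1) * real w\<rfloor>" using gr_bounds by simp
  ultimately show ?thesis by simp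
qed

theorem theorem1:
  fixes w :: nat
  assumes "w > 0"
  shows "(\<exists>A. online A \<and>
            (\<forall>n P. valid_input w n P \<longrightarrow>
               chain_partition n P (A P) \<and>
               int (chains_used n (A P)) \<le> \<lfloor>(1 + sqrt 5) / 2 * real w\<rfloor>))
       \<and> (\<forall>A. online A \<and> (\<forall>n P. valid_input w n P \<longrightarrow> chain_partition n P (A P)) \<longrightarrow>
            (\<exists>n P. semiorder n P \<and> up_growing n P \<and> width n P = w \<and>
               int (chains_used n (A P)) \<ge> \<lfloor>(1 + sqrt 5) / 2 * real w\<rfloor>))"
proof (rule conjI)
  show "\<exists>A. online A \<and> (\<forall>n P. valid_input w n P \<longrightarrow> chain_partition n P (A P) \<and>
      int (chains_used n (A P)) \<le> \<lfloor>(1 + sqrt 5) / 2 * real w\<rfloor>)"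
    using online_chain_root best_fit_chains unfolding gr_def by blast
next
  \<comment> \<open>Since gr (gr - 1) = 1, this is the largest \<open>m\<close> with gr m \<le> w,
    and by \<open>floor_gr\<close> the sum \<open>w + m\<close> is the required number of
    chains.\<close>
  define m where "m = nat \<lfloor>(gr - 1) * real w\<rfloor>"
  have "0 \<le> (gr - 1) * real w" using gr_bounds by simp
  then have m: "real m \<le> (gr - 1) * real w" unfolding m_def by simp
  also have "\<dots> \<le> 1 * real w" using gr_bounds by (intro mult_right_mono) auto
  finally have mw: "m \<le> w" by simp
  have "gr * real m \<le> gr * ((gr - 1) * real w)" using m gr_bounds by (intro mult_left_mono) auto
  also have "\<dots> = (gr * gr - gr) * real w" by (simp add: algebra_simps)
  finally have gm: "gr * real m \<le> real w" by (simp add: gr_sq)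
  show "\<forall>A. online A \<and> (\<forall>n P. valid_input w n P \<longrightarrow> chain_partition n P (A P)) \<longrightarrow>
      (\<exists>n P. semiorder n P \<and> up_growing n P \<and> width n P = w \<and>
        int (chains_used n (A P)) \<ge> \<lfloor>(1 + sqrt 5) / 2 * real w\<rfloor>)"
  proof (intro allI impI)
    fix A assume A: "online A \<and> (\<forall>n P. valid_input w n P \<longrightarrow> chain_partition n P (A P))"
    then interpret spoiler A w m using mw by unfold_locales auto
    obtain n P where "semiorder n P" "up_growing n P" "width n P = w" "w + m \<le> chains_used n (A P)"
      using spoiler_wins A gm by blast
    moreover have "\<lfloor>(1 + sqrt 5) / 2 * real w\<rfloor> = int (w + m)"
      using floor_gr[of w] unfolding gr_def m_def .
    ultimately show "\<exists>n P. semiorder n P \<and> up_growing n P \<and> width n P = w \<and>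
        int (chains_used n (A P)) \<ge> \<lfloor>(1 + sqrt 5) / 2 * real w\<rfloor>"
      by (intro exI[of _ n] exI[of _ P]) simp
  qed
qed

end
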